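(* Let $G$ be a group with a finite generating set $A$ closed under inversion, and suppose that $G$ admits a length non-increasing end-normal synchronously regular convergent prefix-rewriting system $R$ over the alphabet $A$. Then the autostackable structure for $G$ over $A$ constructed from $R$ by the procedure in the context (whose normal form set is the set $\mathcal{N}$ of irreducible words of $R$ and whose flow function is $\Phi$) is a geodesically autostackable structure. In other words, $\Phi$ is a regular bounded flow function for $(G,A,T)$, where $T$ is the spanning tree of $\Gamma_{G,A}$ whose non-backtracking paths from $1_G$ are labeled by the elements of $\mathcal{N}$; every element of $\mathcal{N}$ labels a geodesic in $\Gamma_{G,A}$; and $\alpha(e')<\alpha(e)$ whenever $e,e'$ are directed edges of $\Gamma_{G,A}$ such that $\Phi(e')\ne e'$ and $e'$ is an edge in the path $\Phi(e)$.
   Context: **Basic notation.** $A^*$ is the set of words over $A$; $\lambda$ is the empty word; $|u|$ is the length of $u$; $u(n)$ is the prefix of $u$ of length $n$ (and $u(n)=u$ if $n\ge|u|$); $\mathrm{last}(u)$ is the last letter of $u$; $u^{-1}$ is the formal inverse word. Each $a\in A$ has an inverse letter $a^{-1}\in A$. **Synchronous regularity.** Given $L\subseteq A_1^*\times\cdots\times A_n^*$ and padding symbols $\$_i\notin A_i$, each tuple in $L$ is padded by appending symbols $\$_i$ at the end of the $i$th component until all components have the same length as the longest one; the result is a word over $\prod_i(A_i\cup\{\$_i\})$. $L$ is synchronously regular if the set of padded tuples (the padded extension of $L$) is a regular language. **Prefix-rewriting systems.** A convergent prefix-rewriting system (CP-RS) for $G$ over $A$ is a set $R\subseteq A^*\times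 A^*$ such that $G$ is presented as a monoid by $\mathrm{Mon}\langle A\mid\{u=v:(u,v)\in R\}\rangle$, and the rewritings $uw\to_R vw$ ($(u,v)\in R$, $w\in A^*$) satisfy: there is no infinite chain $w_1\to_R w_2\to_R\cdots$, and each element of $G$ is represented by exactly one irreducible word (a word that cannot be rewritten). $\mathrm{nf}_R(u)$ (or $\mathrm{nf}_R(g)$) denotes the irreducible word representing the same element as $u$ (or representing $g$). $R$ is length non-increasing if $|v|\le|u|$ for all $(u,v)\in R$. $R$ is end-normal if for every $(u,v)\in R$ with $u=wl$, $w$ irreducible and $l\in A$, we have $\mathrm{last}(v)=\mathrm{last}(\mathrm{nf}_R(v))$ (read as: $v$ and $\mathrm{nf}_R(v)$ are either both empty or both nonempty with the same last letter). **Flow functions.** $\Gamma_{G,A}$ is the Cayley graph, with a directed edge $e_{y,a}$ from $y$ to $ya$ labeled $a$ for each $y\in G,a\in A$; $e_{y,a}$ and $e_{ya,a^{-1}}$ have the same underlying undirected edge. $\iota(e),\tau(e)$ are the initial and terminal vertices of $e$, and $d_{G,A}$ is the path metric. Given a spanning tree $T$, $\mathrm{nf}(g)$ is the label of the unique non-backtracking path in $T$ from $1_G$ to $g$. A regular bounded flow function for $(G,A,T)$ is a function $\Phi$ from directed edges to directed paths of $\Gamma_{G,A}$ such that: (1) $\Phi(e)$ has the same initial and terminal vertices as $e$; (2) the lengths of the paths $\Phi(e)$ are uniformly bounded; (3) $\Phi(e)=e$ if the undirected edge underlying $e$ lies in $T$; (4) there is no infinite sequence $e_1,e_2,\dots$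 of edges outside $T$ with $e_{i+1}$ in the path $\Phi(e_i)$ for all $i$; (5) the set of triples $(\mathrm{nf}(\iota(e)),\mathrm{label}(e),\mathrm{label}(\Phi(e)))$ is synchronously regular. An autostackable structure over $A$ consists of such $T$ and $\Phi$; its normal forms are the words $\mathrm{nf}(g)$. Define $\alpha(e)=\tfrac12\big(d_{G,A}(1_G,\iota(e))+d_{G,A}(1_G,\tau(e))\big)$. The structure is geodesically autostackable if each normal form labels a geodesic in $\Gamma_{G,A}$ and, whenever $\Phi(e')\ne e'$ and $e'$ is an edge in the path $\Phi(e)$, we have $\alpha(e')<\alpha(e)$. **The construction from $R$.** Let $\mathcal{N}$ be the set of irreducible words of $R$. A word is minimally reducible if it is not in $\mathcal{N}$ and has the form $ul$ with $u\in\mathcal{N}$, $l\in A$. Let $R'=\{(u,v)\in R: u\text{ is minimally reducible}\}$ (its irreducible words are also $\mathcal{N}$, so $\mathrm{nf}_{R'}=\mathrm{nf}_R$). Fix a (deterministic) finite state automaton $M$ accepting the padded extension of $R'$, let $k$ be its number of states, and let $N=2k$. Put $$S_1=\{(u,\mathrm{nf}_{R'}(u)) : u\text{ minimally reducible},\ |u|<N\},$$ $$S_2=\{(u_1u_2l,\ u_1\,\mathrm{nf}_{R'}(u_2lv_2^{-1})\,v_2) : (u_1u_2l,v)\in R',\ l\in A,\ |u_2|<N,\ |u_2l|\ge N,\ v=v_1v_2,\ v_1=v(|u_1|)\},$$ and $S=S_1\cup S_2$. For each $y\in G$, $a\in A$ with $\mathrm{nf}_R(y)a\notin\mathcal{N}$,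 choose a rule $(\mathrm{nf}_R(y)a,y')\in S$, where the choice is made so that the set of chosen rules is synchronously regular (for instance, the shortlex-least $y'$). Write $\mathrm{nf}_R(y)=ws$ and $y'=wt$, where $s$ and $t$ do not start with the same letter. Then $$\Phi(e_{y,a})=\begin{cases} e_{y,a} & \text{if }\mathrm{nf}_R(y)a\in\mathcal{N}\text{ or }\mathrm{last}(\mathrm{nf}_R(y))=a^{-1},\\ \text{the path starting at }y\text{ labeled }s^{-1}t & \text{otherwise.}\end{cases}$$ *)

theory Defs
  imports
    "HOL-Algebra.Generated_Groups"
    "HOL-Library.Sublist"
    "Graph_Theory.Digraph_Component"
begin

section \<open>Regular and synchronously regular languages\<close>

record ('s, 'b) dfa =
  dfa_states :: "'s set"
  dfa_alphabet :: "'b set"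
  dfa_init :: 's
  dfa_final :: "'s set"
  dfa_trans :: "'s \<Rightarrow> 'b \<Rightarrow> 's"

definition is_dfa :: "('s, 'b) dfa \<Rightarrow> bool" where
  "is_dfa M \<longleftrightarrow> finite (dfa_states M) \<and> finite (dfa_alphabet M) \<and>
     dfa_init M \<in> dfa_states M \<and> dfa_final M \<subseteq> dfa_states M \<and>
     (\<forall>q\<in>dfa_states M. \<forall>x\<in>dfa_alphabet M. dfa_trans M q x \<in> dfa_states M)"

definition dfa_lang :: "('s, 'b) dfa \<Rightarrow> 'b list set" where
  "dfa_lang M = {w \<in> lists (dfa_alphabet M). foldl (dfa_trans M) (dfa_init M) w \<in> dfa_final M}"

text \<open>Finite state sets can be renamed to sets of natural numbers, so fixing the type of
  states is no restriction.\<close>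

definition regular :: "'b list set \<Rightarrow> bool" where
  "regular L \<longleftrightarrow> (\<exists>M :: (nat, 'b) dfa. is_dfa M \<and> dfa_lang M = L)"

text \<open>An \<open>n\<close>-tuple of words is a list of \<open>n\<close> words, and a letter of the padded word is the list of
  its \<open>n\<close> components, \<^term>\<open>None\<close> being the padding symbol in each of them.\<close>

definition pad :: "'a list list \<Rightarrow> 'a option list list" where
  "pad ws = map (\<lambda>i. map (\<lambda>w. if i < length w then Some (w ! i) else None) ws)
                [0..<Max (insert 0 (length ` set ws))]"

definition sync_regular :: "'a list list set \<Rightarrow> bool" where
  "sync_regular L \<longleftrightarrow> regular (pad ` L)"

definition pairs_as_tuples :: "('a list \<times> 'a list) set \<Rightarrow> 'a list list set" where
  "pairs_as_tuples R = {[u, v] | u v. (u, v) \<in> R}"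


section \<open>Words over a set of group elements and prefix-rewriting systems\<close>

definition word_value :: "('a, 'm) monoid_scheme \<Rightarrow> 'a list \<Rightarrow> 'a" where
  "word_value G w = foldr (\<lambda>a g. a \<otimes>\<^bsub>G\<^esub> g) w \<one>\<^bsub>G\<^esub>"

definition inv_word :: "('a, 'm) monoid_scheme \<Rightarrow> 'a list \<Rightarrow> 'a list" where
  "inv_word G w = rev (map (\<lambda>a. inv\<^bsub>G\<^esub> a) w)"

definition prefix_rewrite :: "'a set \<Rightarrow> ('a list \<times> 'a list) set \<Rightarrow> ('a list \<times> 'a list) set" where
  "prefix_rewrite A R = {(u @ w, v @ w) | u v w. (u, v) \<in> R \<and> w \<in> lists A}"

definition irreducibles :: "'a set \<Rightarrow> ('a list \<times> 'a list) set \<Rightarrow> 'a list set" where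
  "irreducibles A R = {w \<in> lists A. \<not> (\<exists>w'. (w, w') \<in> prefix_rewrite A R)}"

definition monoid_rewrite :: "'a set \<Rightarrow> ('a list \<times> 'a list) set \<Rightarrow> ('a list \<times> 'a list) set" where
  "monoid_rewrite A R =
     {(x @ u @ y, x @ v @ y) | x u v y. (u, v) \<in> R \<and> x \<in> lists A \<and> y \<in> lists A}"

definition monoid_congruence :: "'a set \<Rightarrow> ('a list \<times> 'a list) set \<Rightarrow> ('a list \<times> 'a list) set" where
  "monoid_congruence A R = (monoid_rewrite A R \<union> (monoid_rewrite A R)\<inverse>)\<^sup>*"

text \<open>Evaluation of words induces an isomorphism from the monoid presented by the rules
  onto \<open>G\<close>.\<close>

definition monoid_presents ::
    "('a, 'm) monoid_scheme \<Rightarrow> 'a set \<Rightarrow> ('a list \<times> 'a list) set \<Rightarrow> bool" where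
  "monoid_presents G A R \<longleftrightarrow>
     word_value G ` lists A = carrier G \<and>
     (\<forall>u\<in>lists A. \<forall>w\<in>lists A. word_value G u = word_value G w \<longleftrightarrow> (u, w) \<in> monoid_congruence A R)"

definition cprs :: "('a, 'm) monoid_scheme \<Rightarrow> 'a set \<Rightarrow> ('a list \<times> 'a list) set \<Rightarrow> bool" where
  "cprs G A R \<longleftrightarrow>
     R \<subseteq> lists A \<times> lists A \<and>
     monoid_presents G A R \<and>
     \<not> (\<exists>f :: nat \<Rightarrow> 'a list. \<forall>i. f i \<in> lists A \<and> (f i, f (Suc i)) \<in> prefix_rewrite A R) \<and>
     (\<forall>g\<in>carrier G. \<exists>!w. w \<in> irreducibles A R \<and> word_value G w = g)"

definition nf :: "('a, 'm) monoid_scheme \<Rightarrow> 'a set \<Rightarrow> ('a list \<times> 'a list) set \<Rightarrow> 'a \<Rightarrow> 'a list" where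
  "nf G A R g = (THE w. w \<in> irreducibles A R \<and> word_value G w = g)"

definition length_nonincreasing :: "('a list \<times> 'a list) set \<Rightarrow> bool" where
  "length_nonincreasing R \<longleftrightarrow> (\<forall>(u, v)\<in>R. length v \<le> length u)"

definition same_last :: "'a list \<Rightarrow> 'a list \<Rightarrow> bool" where
  "same_last v w \<longleftrightarrow> v = [] \<and> w = [] \<or> v \<noteq> [] \<and> w \<noteq> [] \<and> last v = last w"

definition end_normal ::
    "('a, 'm) monoid_scheme \<Rightarrow> 'a set \<Rightarrow> ('a list \<times> 'a list) set \<Rightarrow> bool" where
  "end_normal G A R \<longleftrightarrow>
     (\<forall>u v w l. (u, v) \<in> R \<and> u = w @ [l] \<and> w \<in> irreducibles A R \<and> l \<in> A
        \<longrightarrow> same_last v (nf G A R (word_value G v)))"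


section \<open>Cayley graphs and autostackable structures\<close>

text \<open>The pair \<open>(y, a)\<close> is the directed edge from \<open>y\<close> to \<open>ya\<close> labeled \<open>a\<close>; a directed path is its
  list of edges.\<close>

definition cayley :: "('a, 'm) monoid_scheme \<Rightarrow> 'a set \<Rightarrow> ('a, 'a \<times> 'a) pre_digraph" where
  "cayley G A = \<lparr> verts = carrier G, arcs = carrier G \<times> A,
                  tail = fst, head = (\<lambda>(y, a). y \<otimes>\<^bsub>G\<^esub> a) \<rparr>"

definition rev_edge :: "('a, 'm) monoid_scheme \<Rightarrow> 'a \<times> 'a \<Rightarrow> 'a \<times> 'a" where
  "rev_edge G = (\<lambda>(y, a). (y \<otimes>\<^bsub>G\<^esub> a, inv\<^bsub>G\<^esub> a))"

fun path_from :: "('a, 'm) monoid_scheme \<Rightarrow> 'a \<Rightarrow> 'a list \<Rightarrow> ('a \<times> 'a) list" where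
  "path_from G y [] = []"
| "path_from G y (a # w) = (y, a) # path_from G (y \<otimes>\<^bsub>G\<^esub> a) w"

definition path_label :: "('a \<times> 'a) list \<Rightarrow> 'a list" where
  "path_label p = map snd p"

definition cayley_dist :: "('a, 'm) monoid_scheme \<Rightarrow> 'a set \<Rightarrow> 'a \<Rightarrow> 'a \<Rightarrow> nat" where
  "cayley_dist G A x y = (LEAST n. \<exists>p. pre_digraph.awalk (cayley G A) x p y \<and> length p = n)"

definition labels_geodesic :: "('a, 'm) monoid_scheme \<Rightarrow> 'a set \<Rightarrow> 'a list \<Rightarrow> bool" where
  "labels_geodesic G A w \<longleftrightarrow>
     (\<exists>x p y. pre_digraph.awalk (cayley G A) x p y \<and> path_label p = w \<and> length p = cayley_dist G A x y)"

definition non_backtracking :: "('a, 'm) monoid_scheme \<Rightarrow> ('a \<times> 'a) list \<Rightarrow> bool" where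
  "non_backtracking G p \<longleftrightarrow> successively (\<lambda>e e'. e' \<noteq> rev_edge G e) p"

text \<open>An undirected subgraph of the Cayley graph is a subgraph whose set of directed edges is closed
  under reversal.  In it, going back and forth along an undirected edge is a directed cycle, so
  the library's notions of a forest and a tree do not apply; the cycles to be excluded are the
  non-backtracking ones.\<close>

definition cayley_spanning_tree ::
    "('a, 'm) monoid_scheme \<Rightarrow> 'a set \<Rightarrow> ('a, 'a \<times> 'a) pre_digraph \<Rightarrow> bool" where
  "cayley_spanning_tree G A T \<longleftrightarrow>
     spanning T (cayley G A) \<and>
     (\<forall>e\<in>arcs T. rev_edge G e \<in> arcs T) \<and>
     strongly_connected T \<and>
     \<not> (\<exists>p. pre_digraph.cycle T p \<and> non_backtracking G p)"

definition tree_nf ::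
    "('a, 'm) monoid_scheme \<Rightarrow> ('a, 'a \<times> 'a) pre_digraph \<Rightarrow> 'a \<Rightarrow> 'a list" where
  "tree_nf G T g =
     path_label (THE p. pre_digraph.awalk T \<one>\<^bsub>G\<^esub> p g \<and> non_backtracking G p)"

definition tree_labels ::
    "('a, 'm) monoid_scheme \<Rightarrow> ('a, 'a \<times> 'a) pre_digraph \<Rightarrow> 'a list set" where
  "tree_labels G T =
     {path_label p | p g. pre_digraph.awalk T \<one>\<^bsub>G\<^esub> p g \<and> non_backtracking G p}"

definition regular_bounded_flow ::
    "('a, 'm) monoid_scheme \<Rightarrow> 'a set \<Rightarrow> ('a, 'a \<times> 'a) pre_digraph \<Rightarrow>
     ('a \<times> 'a \<Rightarrow> ('a \<times> 'a) list) \<Rightarrow> bool" where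
  "regular_bounded_flow G A T \<Phi> \<longleftrightarrow>
     (let \<Gamma> = cayley G A in
       (\<forall>e\<in>arcs \<Gamma>. pre_digraph.awalk \<Gamma> (tail \<Gamma> e) (\<Phi> e) (head \<Gamma> e)) \<and>
       (\<exists>K. \<forall>e\<in>arcs \<Gamma>. length (\<Phi> e) \<le> K) \<and>
       (\<forall>e\<in>arcs T. \<Phi> e = [e]) \<and>
       \<not> (\<exists>f :: nat \<Rightarrow> 'a \<times> 'a. \<forall>i. f i \<in> arcs \<Gamma> - arcs T \<and> f (Suc i) \<in> set (\<Phi> (f i))) \<and>
       sync_regular {[tree_nf G T (tail \<Gamma> e), [snd e], path_label (\<Phi> e)] | e. e \<in> arcs \<Gamma>})"

definition autostackable ::
    "('a, 'm) monoid_scheme \<Rightarrow> 'a set \<Rightarrow> ('a, 'a \<times> 'a) pre_digraph \<Rightarrow>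
     ('a \<times> 'a \<Rightarrow> ('a \<times> 'a) list) \<Rightarrow> bool" where
  "autostackable G A T \<Phi> \<longleftrightarrow> cayley_spanning_tree G A T \<and> regular_bounded_flow G A T \<Phi>"

definition edge_height :: "('a, 'm) monoid_scheme \<Rightarrow> 'a set \<Rightarrow> 'a \<times> 'a \<Rightarrow> real" where
  "edge_height G A e =
     1/2 * (real (cayley_dist G A \<one>\<^bsub>G\<^esub> (tail (cayley G A) e)) +
            real (cayley_dist G A \<one>\<^bsub>G\<^esub> (head (cayley G A) e)))"

definition geodesically_autostackable ::
    "('a, 'm) monoid_scheme \<Rightarrow> 'a set \<Rightarrow> ('a, 'a \<times> 'a) pre_digraph \<Rightarrow>
     ('a \<times> 'a \<Rightarrow> ('a \<times> 'a) list) \<Rightarrow> bool" where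
  "geodesically_autostackable G A T \<Phi> \<longleftrightarrow>
     autostackable G A T \<Phi> \<and>
     (\<forall>g\<in>carrier G. labels_geodesic G A (tree_nf G T g)) \<and>
     (\<forall>e\<in>arcs (cayley G A). \<forall>e'\<in>arcs (cayley G A).
        \<Phi> e' \<noteq> [e'] \<and> e' \<in> set (\<Phi> e) \<longrightarrow> edge_height G A e' < edge_height G A e)"


section \<open>The autostackable structure constructed from a prefix-rewriting system\<close>

definition minimally_reducible :: "'a set \<Rightarrow> ('a list \<times> 'a list) set \<Rightarrow> 'a list set" where
  "minimally_reducible A R =
     {u @ [l] | u l. u \<in> irreducibles A R \<and> l \<in> A \<and> u @ [l] \<notin> irreducibles A R}"

definition minimal_rules :: "'a set \<Rightarrow> ('a list \<times> 'a list) set \<Rightarrow> ('a list \<times> 'a list) set" where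
  "minimal_rules A R = {(u, v) \<in> R. u \<in> minimally_reducible A R}"

definition short_rules ::
    "('a, 'm) monoid_scheme \<Rightarrow> 'a set \<Rightarrow> ('a list \<times> 'a list) set \<Rightarrow> nat \<Rightarrow> ('a list \<times> 'a list) set" where
  "short_rules G A R N =
     {(u, nf G A (minimal_rules A R) (word_value G u)) | u.
        u \<in> minimally_reducible A R \<and> length u < N}"

definition long_rules ::
    "('a, 'm) monoid_scheme \<Rightarrow> 'a set \<Rightarrow> ('a list \<times> 'a list) set \<Rightarrow> nat \<Rightarrow> ('a list \<times> 'a list) set" where
  "long_rules G A R N =
     {(u1 @ u2 @ [l],
       u1 @ nf G A (minimal_rules A R) (word_value G (u2 @ [l] @ inv_word G v2)) @ v2)
      | u1 u2 l v v1 v2.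
        (u1 @ u2 @ [l], v) \<in> minimal_rules A R \<and> l \<in> A \<and>
        length u2 < N \<and> N \<le> length (u2 @ [l]) \<and>
        v = v1 @ v2 \<and> v1 = take (length u1) v}"

definition bounded_rules ::
    "('a, 'm) monoid_scheme \<Rightarrow> 'a set \<Rightarrow> ('a list \<times> 'a list) set \<Rightarrow> nat \<Rightarrow> ('a list \<times> 'a list) set" where
  "bounded_rules G A R N = short_rules G A R N \<union> long_rules G A R N"

text \<open>\<open>c y a\<close> is the right-hand side chosen for the left-hand side \<open>nf(y)a\<close>.\<close>

definition regular_rule_choice ::
    "('a, 'm) monoid_scheme \<Rightarrow> 'a set \<Rightarrow> ('a list \<times> 'a list) set \<Rightarrow> nat \<Rightarrow> ('a \<Rightarrow> 'a \<Rightarrow> 'a list) \<Rightarrow> bool" where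
  "regular_rule_choice G A R N c \<longleftrightarrow>
     (\<forall>y\<in>carrier G. \<forall>a\<in>A. nf G A R y @ [a] \<notin> irreducibles A R
        \<longrightarrow> (nf G A R y @ [a], c y a) \<in> bounded_rules G A R N) \<and>
     sync_regular {[nf G A R y @ [a], c y a] | y a.
        y \<in> carrier G \<and> a \<in> A \<and> nf G A R y @ [a] \<notin> irreducibles A R}"

text \<open>Splitting off the longest common prefix is the only way of writing two words as \<open>ws\<close> and
  \<open>wt\<close> such that \<open>s\<close> and \<open>t\<close> do not start with the same letter.\<close>

definition constructed_flow ::
    "('a, 'm) monoid_scheme \<Rightarrow> 'a set \<Rightarrow> ('a list \<times> 'a list) set \<Rightarrow> ('a \<Rightarrow> 'a \<Rightarrow> 'a list) \<Rightarrow>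
     'a \<times> 'a \<Rightarrow> ('a \<times> 'a) list" where
  "constructed_flow G A R c = (\<lambda>(y, a).
     (let u = nf G A R y;
          w = longest_common_prefix u (c y a);
          s = drop (length w) u;
          t = drop (length w) (c y a)
      in if u @ [a] \<in> irreducibles A R \<or> u \<noteq> [] \<and> last u = inv\<^bsub>G\<^esub> a
         then [(y, a)]
         else path_from G y (inv_word G s @ t)))"

end

theory Submission
  imports Defs
begin

text \<open>
  Since the rules never increase length, normal forms are geodesics, and the distance of \<open>g\<close> from
  the identity is the length of its normal form. The key point is that \<open>\<alpha>\<close> strictly decreases
  along the flow outside the tree, which also yields termination because \<open>2\<alpha>\<close> takes values in the
  natural numbers. Apart from edges going up the tree, \<open>\<Phi>(e\<^bsub>y,a\<^esub>)\<close> only uses edges of the path from the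
  identity labeled by the chosen right-hand side \<open>u1 z v2\<close>. Here \<open>u1 z\<close> represents the same element
  as the prefix \<open>v1\<close> of \<open>v\<close>, and cutting the loops out of the run of \<open>M\<close> on the rest of the rule shows
  that \<open>z\<close> has length at most \<open>2k - 2\<close>, which is less than the length \<open>2k\<close> of the suffix it replaces.
  Hence the edges of \<open>u1 z\<close> are close enough to the identity, and so are those of \<open>v2\<close> except possibly
  the last two; the last one lies in the tree by end-normality, so the one before it ends at the
  parent of \<open>ya\<close>.

  All rules in \<open>S\<close> replace a suffix of bounded length, so the languages involved are finite unions of
  sets \<open>{(u x, u z) | u \<in> L}\<close> with \<open>L\<close> regular and \<open>x\<close>, \<open>z\<close> fixed. Regularity is handled through
  left quotients: a language over a finite alphabet is regular iff it has finitely many of them.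
\<close>

section \<open>Regular languages via left quotients\<close>

text \<open>The left quotient of \<open>L\<close> by \<open>w\<close>, also known as its Brzozowski
  derivative.\<close>

definition lquot :: "'b list \<Rightarrow> 'b list set \<Rightarrow> 'b list set" where
  "lquot w L = {x. w @ x \<in> L}"

lemma mem_lquot [simp]: "x \<in> lquot w L \<longleftrightarrow> w @ x \<in> L"
  by (simp add: lquot_def)

lemma lquot_Nil [simp]: "lquot [] L = L"
  by (simp add: lquot_def)

lemma lquot_lquot: "lquot x (lquot w L) = lquot (w @ x) L"
  by (simp add: lquot_def)

lemma foldl_in_dfa_states:
  assumes "is_dfa M" "q \<in> dfa_states M" "w \<in> lists (dfa_alphabet M)"
  shows "foldl (dfa_trans M) q w \<in> dfa_states M"
  using assms(2,3) by (induction w arbitrary: q) (use assms(1) in \<open>auto simp: is_dfa_def\<close>)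

lemma dfa_card_pos:
  assumes "is_dfa M"
  shows "0 < card (dfa_states M)"
  using assms unfolding is_dfa_def card_gt_0_iff by blast

text \<open>This is the Myhill-Nerode theorem. The state reached by \<open>w\<close> determines the
  quotient by \<open>w\<close>, which is empty if \<open>w\<close> leaves the alphabet. Conversely,
  the quotients serve as states, coded by natural numbers to fit \<open>regular\<close>. The finite
  alphabet is asked for separately because the letter type may be infinite.\<close>

lemma regular_iff_finite_lquots:
  "regular L \<longleftrightarrow> (\<exists>X. finite X \<and> L \<subseteq> lists X) \<and> finite (range (\<lambda>w. lquot w L))"
proof
  assume "regular L"
  then obtain M :: "(nat, 'a) dfa" where M: "is_dfa M" and L: "dfa_lang M = L"
    by (auto simp: regular_def)
  let ?X = "dfa_alphabet M"
  let ?Q = "\<lambda>q. {x \<in> lists ?X. foldl (dfa_trans M) q x \<in> dfa_final M}"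
  have "lquot w L \<in> insert {} (?Q ` dfa_states M)" for w
  proof (cases "w \<in> lists ?X")
    case True
    then have "lquot w L = ?Q (foldl (dfa_trans M) (dfa_init M) w)"
      by (auto simp: L[symmetric] dfa_lang_def)
    moreover have "foldl (dfa_trans M) (dfa_init M) w \<in> dfa_states M"
      using foldl_in_dfa_states[OF M _ True] M by (auto simp: is_dfa_def)
    ultimately show ?thesis by blast
  next
    case False
    then have "lquot w L = {}" by (auto simp: L[symmetric] dfa_lang_def)
    then show ?thesis by simp
  qed
  then have "range (\<lambda>w. lquot w L) \<subseteq> insert {} (?Q ` dfa_states M)" by blast
  moreover have "finite (insert {} (?Q ` dfa_states M))" using M by (simp add: is_dfa_def)
  ultimately have "finite (range (\<lambda>w. lquot w L))" by (rule finite_subset)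
  moreover have "finite ?X" "L \<subseteq> lists ?X" using M by (auto simp: is_dfa_def L[symmetric] dfa_lang_def)
  ultimately show "(\<exists>X. finite X \<and> L \<subseteq> lists X) \<and> finite (range (\<lambda>w. lquot w L))" by blast
next
  let ?D = "range (\<lambda>w. lquot w L)"
  assume "(\<exists>X. finite X \<and> L \<subseteq> lists X) \<and> finite ?D"
  then obtain X where X: "finite X" "L \<subseteq> lists X" and D: "finite ?D" by blast
  obtain f :: "'a list set \<Rightarrow> nat" and n where "f ` ?D = {i. i < n}" and f: "inj_on f ?D"
    using finite_imp_inj_to_nat_seg[OF D] by blast
  define M :: "(nat, 'a) dfa" where
    "M = \<lparr>dfa_states = f ` ?D, dfa_alphabet = X, dfa_init = f L, dfa_final = f ` {K \<in> ?D. [] \<in> K},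
          dfa_trans = (\<lambda>q x. f (lquot [x] (inv_into ?D f q)))\<rparr>"
  have LD: "L \<in> ?D" using lquot_Nil[of L] by (metis rangeI)
  have run: "foldl (dfa_trans M) (f L) w = f (lquot w L)" for w
  proof (induction w rule: rev_induct)
    case (snoc x w)
    have "inv_into ?D f (f (lquot w L)) = lquot w L" using f by (intro inv_into_f_f) auto
    with snoc show ?case by (simp add: M_def lquot_lquot)
  qed (simp add: M_def)
  have "lquot [x] (inv_into ?D f q) \<in> ?D" if q: "q \<in> f ` ?D" for q x
  proof -
    obtain w where "inv_into ?D f q = lquot w L" using inv_into_into[OF q] by blast
    then show ?thesis by (simp add: lquot_lquot)
  qed
  then have "is_dfa M"
    unfolding is_dfa_def using X D LD by (simp add: M_def image_subset_iff)
  moreover have "dfa_lang M = L"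
  proof -
    have "f (lquot w L) \<in> f ` {K \<in> ?D. [] \<in> K} \<longleftrightarrow> w \<in> L" for w
      using inj_on_image_mem_iff[OF f, of "lquot w L" "{K \<in> ?D. [] \<in> K}"] by auto
    then have "w \<in> dfa_lang M \<longleftrightarrow> w \<in> L" for w
      using X run[of w] by (auto simp: dfa_lang_def M_def)
    then show ?thesis by blast
  qed
  ultimately show "regular L" unfolding regular_def by blast
qed

text \<open>\<open>F\<close> may be any finite set containing the quotients, so for a closure
  property it suffices to describe each quotient by data from a finite range.\<close>

lemma regularI:
  assumes "finite X" "L \<subseteq> lists X" "finite F" "\<And>w. lquot w L \<in> F"
  shows "regular L"
proof -
  have "range (\<lambda>w. lquot w L) \<subseteq> F" using assms(4) by (rule image_subsetI)
  then have "finite (range (\<lambda>w. lquot w L))" by (rule finite_subset) (rule assms(3))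
  moreover have "\<exists>X. finite X \<and> L \<subseteq> lists X" using assms(1,2) by (intro exI[of _ X] conjI)
  ultimately show ?thesis unfolding regular_iff_finite_lquots by (intro conjI)
qed

lemma regularE:
  assumes "regular L"
  obtains X where "finite X" "L \<subseteq> lists X" "finite (range (\<lambda>w. lquot w L))"
  using assms unfolding regular_iff_finite_lquots by blast

section \<open>Closure properties of regular languages\<close>

lemma regular_binop:
  assumes "regular K" "regular L" and sub: "f K L \<subseteq> K \<union> L"
    and lq: "\<And>w. lquot w (f K L) = f (lquot w K) (lquot w L)"
  shows "regular (f K L)"
proof -
  obtain X where X: "finite X" "K \<subseteq> lists X" "finite (range (\<lambda>w. lquot w K))"
    using assms(1) by (rule regularE)
  obtain Y where Y: "finite Y" "L \<subseteq> lists Y" "finite (range (\<lambda>w. lquot w L))"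
    using assms(2) by (rule regularE)
  show ?thesis
  \<comment> \<open>The product construction: a pair of quotients of the arguments determines the
    quotient of the result.\<close>
  proof (rule regularI[of "X \<union> Y" _ "(\<lambda>(P, Q). f P Q) ` (range (\<lambda>w. lquot w K) \<times> range (\<lambda>w. lquot w L))"])
    show "f K L \<subseteq> lists (X \<union> Y)"
      using sub X(2) Y(2) by (meson Un_least lists_mono order_trans Un_upper1 Un_upper2)
    show "lquot w (f K L) \<in> (\<lambda>(P, Q). f P Q) ` (range (\<lambda>w. lquot w K) \<times> range (\<lambda>w. lquot w L))" for w
      by (subst lq) blast
  qed (use X Y in auto)
qed

lemma regular_Un: "regular K \<Longrightarrow> regular L \<Longrightarrow> regular (K \<union> L)"
  by (rule regular_binop[where f = "(\<union>)"]) (auto simp: lquot_def)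

lemma regular_Int: "regular K \<Longrightarrow> regular L \<Longrightarrow> regular (K \<inter> L)"
  by (rule regular_binop[where f = "(\<inter>)"]) (auto simp: lquot_def)

lemma regular_Diff: "regular K \<Longrightarrow> regular L \<Longrightarrow> regular (K - L)"
  by (rule regular_binop[where f = "(-)"]) (auto simp: lquot_def)

lemma regular_empty: "regular {}"
  by (rule regularI[of "{}" _ "{{}}"]) (auto simp: lquot_def)

lemma regular_UN: "finite I \<Longrightarrow> (\<And>i. i \<in> I \<Longrightarrow> regular (L i)) \<Longrightarrow> regular (\<Union>i\<in>I. L i)"
  by (induction I rule: finite_induct) (auto intro: regular_empty regular_Un)

lemma regular_lists: "finite X \<Longrightarrow> regular (lists X)"
  by (rule regularI[of X _ "{lists X, {}}"]) (auto simp: lquot_def)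

lemma regular_singleton: "regular {w}"
proof (rule regularI[of "set w" _ "insert {} ((\<lambda>n. {drop n w}) ` {..length w})"])
  fix x
  show "lquot x {w} \<in> insert {} ((\<lambda>n. {drop n w}) ` {..length w})"
  proof (cases "\<exists>y. w = x @ y")
    case True
    then have "lquot x {w} = {drop (length x) w}" "length x \<le> length w" by (auto simp: lquot_def)
    then show ?thesis by blast
  qed (auto simp: lquot_def)
qed auto

lemma regular_finite: "finite L \<Longrightarrow> regular L"
  using regular_UN[of L "\<lambda>w. {w}"] regular_singleton by auto

lemma regular_lquot: "regular L \<Longrightarrow> regular (lquot w L)"
proof (erule regularE)
  fix X assume "finite X" "L \<subseteq> lists X" "finite (range (\<lambda>w. lquot w L))"
  then show ?thesis by (intro regularI[of X _ "range (\<lambda>w. lquot w L)"]) (auto simp: lquot_lquot)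
qed

lemma regular_rquot:
  assumes "regular L"
  shows "regular {w. w @ s \<in> L}"
proof -
  obtain X where X: "finite X" "L \<subseteq> lists X" and fin: "finite (range (\<lambda>w. lquot w L))"
    using assms by (rule regularE)
  let ?F = "(\<lambda>K. {w. w @ s \<in> K}) ` range (\<lambda>w. lquot w L)"
  have "lquot w {w. w @ s \<in> L} = {x. x @ s \<in> lquot w L}" for w
    by (simp add: lquot_def)
  then have "lquot w {w. w @ s \<in> L} \<in> ?F" for w by blast
  then show ?thesis
    using X fin by (intro regularI[of X _ ?F]) auto
qed

text \<open>This is the subset construction. As \<open>f\<close> need not be injective, several
  words \<open>v\<close> may lie above \<open>w\<close>; the quotient of the image is the union of
  the images of their quotients, and there are only finitely many such unions.\<close>

lemma regular_map_image:
  assumes "regular L"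
  shows "regular (map f ` L)"
proof -
  obtain X where X: "finite X" "L \<subseteq> lists X" and fin: "finite (range (\<lambda>w. lquot w L))"
    using assms by (rule regularE)
  let ?u = "\<lambda>E. \<Union>D\<in>E. map f ` D"
  let ?F = "?u ` Pow (range (\<lambda>w. lquot w L))"
  have "lquot w (map f ` L) = ?u {lquot v L |v. map f v = w}" for w
  proof (intro equalityI subsetI)
    fix x assume "x \<in> lquot w (map f ` L)"
    then obtain t where t: "t \<in> L" "map f t = w @ x" by (metis imageE mem_lquot)
    then obtain v y where "t = v @ y" "map f v = w" "map f y = x" by (auto simp: map_eq_append_conv)
    with t show "x \<in> ?u {lquot v L |v. map f v = w}" by auto
  next
    fix x assume "x \<in> ?u {lquot v L |v. map f v = w}"
    then obtain v y where "v @ y \<in> L" "map f v = w" "map f y = x" by auto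
    then show "x \<in> lquot w (map f ` L)" by (metis imageI map_append mem_lquot)
  qed
  then have "lquot w (map f ` L) \<in> ?F" for w by blast
  moreover have "map f ` L \<subseteq> lists (f ` X)" using X(2) by (auto simp: lists_image)
  moreover have "finite ?F" using fin by simp
  ultimately show ?thesis using X(1) by (intro regularI[of "f ` X" _ ?F]) auto
qed

text \<open>The preimage is taken inside a regular \<open>L\<close> to keep the alphabet finite:
  infinitely many letters may have the same image under \<open>f\<close>.\<close>

lemma regular_map_vimage:
  assumes "regular L" "regular K"
  shows "regular {w \<in> L. map f w \<in> K}"
proof -
  obtain X where X: "finite X" "L \<subseteq> lists X" "finite (range (\<lambda>w. lquot w L))"
    using assms(1) by (rule regularE)
  obtain Y where Y: "finite (range (\<lambda>w. lquot w K))"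
    using assms(2) by (rule regularE)
  let ?h = "\<lambda>(P, Q). {x \<in> P. map f x \<in> Q}"
  let ?F = "?h ` (range (\<lambda>w. lquot w L) \<times> range (\<lambda>w. lquot w K))"
  have "lquot w {w \<in> L. map f w \<in> K} = ?h (lquot w L, lquot (map f w) K)" for w
    by (simp add: lquot_def)
  then have "lquot w {w \<in> L. map f w \<in> K} \<in> ?F" for w by blast
  moreover have "finite ?F" using X(3) Y by simp
  moreover have "{w \<in> L. map f w \<in> K} \<subseteq> lists X" using X(2) by blast
  ultimately show ?thesis using X(1) by (intro regularI[of X _ ?F])
qed

text \<open>After reading \<open>w\<close>, either the first factor is still being read, or it has
  ended at some prefix \<open>x\<close> of \<open>w\<close> and the rest lies in a quotient of
  \<open>L\<close>. So a quotient is determined by one quotient of \<open>K\<close> and a set of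
  quotients of \<open>L\<close>.\<close>

lemma regular_conc:
  assumes "regular K" "regular L"
  shows "regular {x @ y |x y. x \<in> K \<and> y \<in> L}"
proof -
  let ?c = "\<lambda>K. {x @ y |x y. x \<in> K \<and> y \<in> L}"
  obtain X where X: "finite X" "K \<subseteq> lists X" "finite (range (\<lambda>w. lquot w K))"
    using assms(1) by (rule regularE)
  obtain Y where Y: "finite Y" "L \<subseteq> lists Y" "finite (range (\<lambda>w. lquot w L))"
    using assms(2) by (rule regularE)
  let ?h = "\<lambda>(P, Q). ?c P \<union> \<Union>Q"
  let ?F = "?h ` (range (\<lambda>w. lquot w K) \<times> Pow (range (\<lambda>w. lquot w L)))"
  have lq: "lquot w (?c K) = ?h (lquot w K, {lquot y L |x y. w = x @ y \<and> x \<in> K})" for w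
  proof (intro equalityI subsetI)
    fix t assume "t \<in> lquot w (?c K)"
    then obtain x y where xy: "w @ t = x @ y" "x \<in> K" "y \<in> L" by auto
    then consider u where "x = w @ u" "t = u @ y" | u where "w = x @ u" "u @ t = y"
      by (auto simp: append_eq_append_conv2)
    then show "t \<in> ?h (lquot w K, {lquot y L |x y. w = x @ y \<and> x \<in> K})"
    proof cases
      case 1
      then show ?thesis using xy by auto
    next
      case 2
      then have "t \<in> lquot u L" using xy by simp
      then show ?thesis using 2 xy by blast
    qed
  next
    fix t assume "t \<in> ?h (lquot w K, {lquot y L |x y. w = x @ y \<and> x \<in> K})"
    then consider x y where "t = x @ y" "w @ x \<in> K" "y \<in> L"
      | x y where "y @ t \<in> L" "w = x @ y" "x \<in> K" by auto
    then show "t \<in> lquot w (?c K)"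
    proof cases
      case 1
      then have "w @ t = (w @ x) @ y" by simp
      with 1 show ?thesis unfolding mem_lquot by blast
    next
      case 2
      then have "w @ t = x @ (y @ t)" by simp
      with 2 show ?thesis unfolding mem_lquot by blast
    qed
  qed
  show ?thesis
  proof (rule regularI)
    show "lquot w (?c K) \<in> ?F" for w by (subst lq, intro imageI SigmaI) auto
    show "finite ?F" using X(3) Y(3) by simp
    show "?c K \<subseteq> lists (X \<union> Y)"
      using X(2) Y(2) lists_mono[of X "X \<union> Y"] lists_mono[of Y "X \<union> Y"] by fastforce
    show "finite (X \<union> Y)" using X(1) Y(1) by simp
  qed
qed

lemma regular_append_word:
  assumes "regular L"
  shows "regular ((\<lambda>w. w @ s) ` L)"
proof -
  have "(\<lambda>w. w @ s) ` L = {x @ y |x y. x \<in> L \<and> y \<in> {s}}" by auto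
  then show ?thesis using regular_conc[OF assms regular_singleton[of s]] by simp
qed

lemma regular_prepend_word:
  assumes "regular L"
  shows "regular ((@) s ` L)"
proof -
  have "(@) s ` L = {x @ y |x y. x \<in> {s} \<and> y \<in> L}" by auto
  then show ?thesis using regular_conc[OF regular_singleton[of s] assms] by simp
qed

text \<open>A shortest accepted continuation visits no state twice.\<close>

lemma dfa_short_accepting_run:
  assumes M: "is_dfa M" and q: "q \<in> dfa_states M" and r: "r \<in> lists (dfa_alphabet M)"
    and acc: "foldl (dfa_trans M) q r \<in> dfa_final M"
  obtains r' where "r' \<in> lists (dfa_alphabet M)" "length r' < card (dfa_states M)"
    "foldl (dfa_trans M) q r' \<in> dfa_final M"
proof -
  let ?P = "\<lambda>r. r \<in> lists (dfa_alphabet M) \<and> foldl (dfa_trans M) q r \<in> dfa_final M"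
  define s where "s = arg_min length ?P"
  have s: "?P s" unfolding s_def by (rule arg_min_natI[of ?P r]) (use r acc in simp)
  have min: "length s \<le> length t" if "?P t" for t
    unfolding s_def by (rule arg_min_nat_le[of ?P]) (use that in simp)
  let ?f = "\<lambda>i. foldl (dfa_trans M) q (take i s)"
  \<comment> \<open>The run of \<open>s\<close>, with its starting state, has
    \<open>length s + 1\<close> positions, so a repetition is forced already when
    \<open>length s\<close> equals the number of states.\<close>
  have "\<not> inj_on ?f {..length s}" if "card (dfa_states M) \<le> length s"
  proof
    assume "inj_on ?f {..length s}"
    moreover have "?f ` {..length s} \<subseteq> dfa_states M"
      using foldl_in_dfa_states[OF M q] s by (fastforce simp: in_lists_conv_set dest: in_set_takeD)
    ultimately have "card {..length s} \<le> card (dfa_states M)"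
      using M by (intro card_inj_on_le) (auto simp: is_dfa_def)
    with that show False by simp
  qed
  moreover have "inj_on ?f {..length s}"
  proof (rule linorder_inj_onI)
    fix i j assume ij: "i < j" "i \<in> {..length s}" "j \<in> {..length s}"
    show "?f i \<noteq> ?f j"
    proof
      assume eq: "?f i = ?f j"
      have "foldl (dfa_trans M) q (take i s @ drop j s) = foldl (dfa_trans M) q (take j s @ drop j s)"
        using eq by (simp only: foldl_append)
      then have "?P (take i s @ drop j s)"
        using s by (auto simp: in_lists_conv_set dest: in_set_takeD in_set_dropD)
      from min[OF this] ij show False by simp
    qed
  qed auto
  ultimately have "length s < card (dfa_states M)" by force
  with s that show thesis by blast
qed


section \<open>Padded tuples\<close>

text \<open>Defined on all words of columns, not only on paddings, so that it distributes over
  concatenation. In \<open>pumped_suffix\<close> it is applied to a word that is only known to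
  complete a padding.\<close>

definition unpad :: "nat \<Rightarrow> 'a option list list \<Rightarrow> 'a list" where
  "unpad i p = List.map_filter (\<lambda>c. c ! i) p"

lemma unpad_append: "unpad i (p @ q) = unpad i p @ unpad i q"
  by (simp add: unpad_def map_filter_def)

lemma length_unpad_le: "length (unpad i p) \<le> length p"
  by (simp add: unpad_def map_filter_def)

lemma length_pad: "length (pad ws) = Max (insert 0 (length ` set ws))"
  by (simp add: pad_def)

lemma nth_pad:
  "i < length (pad ws) \<Longrightarrow> pad ws ! i = map (\<lambda>w. if i < length w then Some (w ! i) else None) ws"
  by (simp add: pad_def)

lemma unpad_pad: "i < length ws \<Longrightarrow> unpad i (pad ws) = ws ! i"
proof -
  assume i: "i < length ws"
  let ?n = "length (pad ws)"
  have le: "length (ws ! i) \<le> ?n" using i by (simp add: length_pad)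
  have "map (\<lambda>c. c ! i) (pad ws) = map (\<lambda>j. if j < length (ws ! i) then Some (ws ! i ! j) else None) [0..<?n]"
    using i by (simp add: pad_def)
  also have "[0..<?n] = [0..<length (ws ! i)] @ [length (ws ! i)..<?n]"
    using le by (metis le_add_diff_inverse upt_add_eq_append zero_le)
  also have "map (\<lambda>j. if j < length (ws ! i) then Some (ws ! i ! j) else None) \<dots>
      = map Some (map ((!) (ws ! i)) [0..<length (ws ! i)]) @ map (\<lambda>_. None) [length (ws ! i)..<?n]"
    by simp
  finally have *: "map (\<lambda>c. c ! i) (pad ws) =
      map Some (ws ! i) @ map (\<lambda>_. None) [length (ws ! i)..<?n]" by (simp only: map_nth)
  have "unpad i p = List.map_filter id (map (\<lambda>c. c ! i) p)" for p :: "'a option list list"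
    by (induction p) (auto simp: unpad_def map_filter_simps split: option.split)
  from this[of "pad ws"] show ?thesis unfolding * by (simp add: map_filter_def comp_def)
qed

lemma length_pad_Nil: "length (pad []) = 0"
  by (simp add: length_pad)

lemma length_pad_Cons: "length (pad (w # ws)) = max (length w) (length (pad ws))"
  by (simp only: length_pad list.set image_insert insert_commute[of 0 "length w"]) (rule Max_insert; simp)

lemma length_pad_take: "length (pad (map (take n) ws)) = min n (length (pad ws))"
  by (induction ws) (auto simp: length_pad_Nil length_pad_Cons)

lemma length_pad_drop: "length (pad (map (drop n) ws)) = length (pad ws) - n"
  by (induction ws) (auto simp: length_pad_Nil length_pad_Cons)

text \<open>Holds for every \<open>n\<close>: a component shorter than \<open>n\<close> is padded
  inside the first factor and leaves the empty word for the second.\<close>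

lemma pad_take_drop: "pad ws = pad (map (take n) ws) @ pad (map (drop n) ws)"
proof (rule nth_equalityI)
  show "length (pad ws) = length (pad (map (take n) ws) @ pad (map (drop n) ws))"
    by (simp add: length_pad_take length_pad_drop)
  fix i assume "i < length (pad ws)"
  then show "pad ws ! i = (pad (map (take n) ws) @ pad (map (drop n) ws)) ! i"
    by (auto simp: nth_append nth_pad length_pad_take length_pad_drop min_def)
qed

lemma take_pad:
  assumes "n \<le> length (pad ws)"
  shows "take n (pad ws) = pad (map (take n) ws)" "drop n (pad ws) = pad (map (drop n) ws)"
proof -
  have n: "length (pad (map (take n) ws)) = n" using assms by (simp add: length_pad_take)
  have "take n (pad (map (take n) ws) @ pad (map (drop n) ws)) = pad (map (take n) ws)"
    "drop n (pad (map (take n) ws) @ pad (map (drop n) ws)) = pad (map (drop n) ws)"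
    using n by simp_all
  then show "take n (pad ws) = pad (map (take n) ws)" "drop n (pad ws) = pad (map (drop n) ws)"
    by (simp_all only: pad_take_drop[symmetric])
qed

lemma pad_inj: "pad ws = pad ws' \<Longrightarrow> length ws = length ws' \<Longrightarrow> ws = ws'"
  by (rule nth_equalityI) (metis unpad_pad)+

lemma pad_pair_inj: "pad [u, v] = pad [u', v'] \<longleftrightarrow> u = u' \<and> v = v'"
  using pad_inj[of "[u, v]" "[u', v']"] by auto

lemma pad_pair_mem: "pad [u, v] \<in> pad ` pairs_as_tuples R \<longleftrightarrow> (u, v) \<in> R"
  by (auto simp: pairs_as_tuples_def pad_pair_inj)

text \<open>If \<open>v1\<close> is shorter than \<open>u1\<close>, then \<open>pad [u1, v1]\<close>
  ends with padding symbols in the second component, and no letter may follow them; hence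
  \<open>v2 = []\<close> in that case.\<close>

lemma pad_pair_append:
  assumes "length v1 = length u1 \<or> length v1 \<le> length u1 \<and> v2 = []"
  shows "pad [u1 @ u2, v1 @ v2] = pad [u1, v1] @ pad [u2, v2]"
  by (subst pad_take_drop[of _ "length u1"]) (use assms in auto)

lemma pad_diag: "pad [w, w] = map (\<lambda>a. [Some a, Some a]) w"
  by (rule nth_equalityI) (auto simp: length_pad nth_pad)

lemma pad_only_first: "pad (x # replicate k []) = map (\<lambda>a. Some a # replicate k None) x"
proof (rule nth_equalityI)
  show 1: "length (pad (x # replicate k [])) = length (map (\<lambda>a. Some a # replicate k None) x)"
    by (cases "k = 0") (auto simp: length_pad)
  fix i assume "i < length (pad (x # replicate k []))"
  with 1 show "pad (x # replicate k []) ! i = map (\<lambda>a. Some a # replicate k None) x ! i"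
    by (auto simp: nth_pad)
qed

text \<open>As \<open>u\<close> is the longer word, no column is padded in its first component and
  \<open>the\<close> never meets \<open>None\<close>. For length non-increasing rules the projection
  to left-hand sides is thus a letterwise map, under which regularity is preserved.\<close>

lemma map_fst_pad:
  assumes "length v \<le> length u"
  shows "map (\<lambda>c. the (c ! 0)) (pad [u, v]) = u"
  by (rule nth_equalityI) (use assms in \<open>auto simp: length_pad nth_pad\<close>)

section \<open>Synchronously regular sets of tuples and pairs with a common prefix\<close>

lemma sync_regular_UN:
  assumes "finite I" "\<And>i. i \<in> I \<Longrightarrow> sync_regular (L i)"
  shows "sync_regular (\<Union>i\<in>I. L i)"
  using regular_UN[OF assms(1), of "\<lambda>i. pad ` L i"] assms(2) unfolding sync_regular_def
  by (simp add: image_UN)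

lemma sync_regular_Un: "sync_regular K \<Longrightarrow> sync_regular L \<Longrightarrow> sync_regular (K \<union> L)"
  unfolding sync_regular_def image_Un by (rule regular_Un)

text \<open>The fixed words \<open>ws\<close> affect only the first \<open>n\<close> columns, where
  \<open>n\<close> is their greatest length. Cutting the varying word at \<open>n\<close> leaves
  finitely many beginnings, each followed by a quotient of \<open>L\<close> padded in all other
  components.\<close>

lemma sync_regular_Cons_fixed:
  fixes ws :: "'a list list"
  assumes L: "regular L"
  shows "sync_regular {x # ws |x. x \<in> L}"
proof -
  define n where "n = Max (insert 0 (length ` set ws))"
  obtain X where X: "finite X" "L \<subseteq> lists X" using L by (rule regularE)
  define I where "I = {x. set x \<subseteq> X \<and> length x \<le> n}"
  have finI: "finite I" unfolding I_def by (rule finite_lists_length_le[OF X(1)])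
  \<comment> \<open>A beginning shorter than \<open>n\<close> is the whole word, so only the empty
    word may follow it.\<close>
  let ?tail = "\<lambda>x. if length x < n then lquot x L \<inter> {[]} else lquot x L"
  let ?e = "\<lambda>a. Some a # replicate (length ws) None"
  have len: "length w \<le> n" if "w \<in> set ws" for w using that by (simp add: n_def)
  have dr: "map (drop n) ws = replicate (length ws) []"
    using len by (auto simp: map_replicate_const[symmetric] intro!: map_cong)
  have tk: "map (take n) ws = ws" using len by (auto intro!: map_idI)
  have pad_split: "pad ((x @ y) # ws) = pad (x # ws) @ map ?e y"
    if "length x = n \<or> length x \<le> n \<and> y = []" for x y :: "'a list"
  proof -
    have *: "take n (x @ y) = x" "drop n (x @ y) = y" using that by auto
    show ?thesis
      by (subst pad_take_drop[of _ n]) (simp only: list.map * tk dr pad_only_first)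
  qed
  have "pad ` {x # ws |x. x \<in> L} = (\<Union>x\<in>I. (@) (pad (x # ws)) ` map ?e ` ?tail x)"
  proof (intro equalityI subsetI)
    fix p assume "p \<in> pad ` {x # ws |x. x \<in> L}"
    then obtain x where x: "x \<in> L" "p = pad (x # ws)" by auto
    have "take n x \<in> I" using x(1) X(2) by (auto simp: I_def in_lists_conv_set dest!: in_set_takeD)
    moreover have "drop n x \<in> ?tail (take n x)" using x by auto
    moreover have "p = pad (take n x # ws) @ map ?e (drop n x)"
      using pad_split[of "take n x" "drop n x"] x by (cases "n \<le> length x") auto
    ultimately show "p \<in> (\<Union>x\<in>I. (@) (pad (x # ws)) ` map ?e ` ?tail x)" by blast
  next
    fix p assume "p \<in> (\<Union>x\<in>I. (@) (pad (x # ws)) ` map ?e ` ?tail x)"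
    then obtain x y where xy: "x \<in> I" "y \<in> ?tail x" "p = pad (x # ws) @ map ?e y" by blast
    then have "p = pad ((x @ y) # ws)" using pad_split[of x y] by (auto simp: I_def split: if_splits)
    moreover have "x @ y \<in> L" using xy(2) by (auto split: if_splits)
    ultimately show "p \<in> pad ` {x # ws |x. x \<in> L}" by blast
  qed
  moreover have "regular (?tail x)" for x
    using regular_lquot[OF L, of x] by (simp add: regular_Int regular_singleton)
  ultimately show ?thesis
    unfolding sync_regular_def
    using finI by (auto intro!: regular_UN regular_prepend_word regular_map_image simp del: UN_simps)
qed

lemma sync_regular_common_prefix:
  assumes "regular L"
  shows "sync_regular {[u @ x, u @ z] |u. u \<in> L}"
proof -
  have "pad [u @ x, u @ z] = map (\<lambda>a. [Some a, Some a]) u @ pad [x, z]" for u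
    using pad_pair_append[of u u z x] by (simp add: pad_diag)
  then have "pad ` {[u @ x, u @ z] |u. u \<in> L} = (\<lambda>w. w @ pad [x, z]) ` map (\<lambda>a. [Some a, Some a]) ` L"
    by (simp add: Setcompr_eq_image image_image)
  then show ?thesis unfolding sync_regular_def
    using assms by (simp add: regular_append_word regular_map_image)
qed

lemma regular_common_prefixes:
  assumes "finite X" "sync_regular (pairs_as_tuples R)"
  shows "regular {u \<in> lists X. (u @ x, u @ z) \<in> R}"
proof -
  have "regular {u \<in> lists X. map (\<lambda>a. [Some a, Some a]) u \<in> {w. w @ pad [x, z] \<in> pad ` pairs_as_tuples R}}"
    using assms by (intro regular_map_vimage regular_lists regular_rquot) (simp_all add: sync_regular_def)
  also have "map (\<lambda>a. [Some a, Some a]) u @ pad [x, z] = pad [u @ x, u @ z]" for u :: "'a list"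
    using pad_pair_append[of u u z x] by (simp add: pad_diag)
  then have "{u \<in> lists X. map (\<lambda>a. [Some a, Some a]) u \<in> {w. w @ pad [x, z] \<in> pad ` pairs_as_tuples R}} =
      {u \<in> lists X. (u @ x, u @ z) \<in> R}"
    by (simp add: pad_pair_mem)
  finally show ?thesis .
qed

text \<open>Induction over the index set: words that already have a rule keep it, and the remaining
  ones served by the new index form a regular language.\<close>

lemma regular_selection:
  fixes x z :: "'i \<Rightarrow> 'a list"
  assumes "finite I" "\<And>i. i \<in> I \<Longrightarrow> regular (Q i)"
  shows "\<exists>f. (\<forall>w\<in>(\<Union>i\<in>I. (\<lambda>u. u @ x i) ` Q i). \<exists>i\<in>I. \<exists>u\<in>Q i. w = u @ x i \<and> f w = u @ z i) \<and>
     sync_regular {[w, f w] |w. w \<in> (\<Union>i\<in>I. (\<lambda>u. u @ x i) ` Q i)}"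
  using assms
proof (induction I rule: finite_induct)
  case empty
  show ?case by (simp add: sync_regular_def regular_empty)
next
  case (insert i I)
  let ?D = "\<lambda>I. \<Union>i\<in>I. (\<lambda>u. u @ x i) ` Q i"
  obtain f where f: "\<forall>w\<in>?D I. \<exists>i\<in>I. \<exists>u\<in>Q i. w = u @ x i \<and> f w = u @ z i"
    and reg: "sync_regular {[w, f w] |w. w \<in> ?D I}"
    using insert.IH insert.prems by auto
  \<comment> \<open>For a new word \<open>w = u @ x i\<close> the \<open>take\<close> recovers
    \<open>u\<close>.\<close>
  define g where "g w = (if w \<in> ?D I then f w else take (length w - length (x i)) w @ z i)" for w
  define P where "P = {u \<in> Q i. u @ x i \<notin> ?D I}"
  have "regular (?D I)"
    using insert.hyps insert.prems by (intro regular_UN regular_append_word) auto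
  then have "regular (Q i - {u. u @ x i \<in> ?D I})"
    using insert.prems by (intro regular_Diff regular_rquot) auto
  then have P: "regular P" by (simp add: P_def set_diff_eq)
  have "{[w, g w] |w. w \<in> ?D (insert i I)} =
      {[u @ x i, u @ z i] |u. u \<in> P} \<union> {[w, f w] |w. w \<in> ?D I}" (is "?L = ?R")
  proof (intro equalityI subsetI)
    fix t assume "t \<in> ?L"
    then obtain w where w: "t = [w, g w]" "w \<in> ?D (insert i I)" by blast
    show "t \<in> ?R"
    proof (cases "w \<in> ?D I")
      case True
      then have "g w = f w" by (simp only: g_def if_True)
      with True w show ?thesis by blast
    next
      case False
      then obtain u where "w = u @ x i" "u \<in> P" using w by (auto simp: P_def)
      with False w show ?thesis by (auto simp: g_def)
    qed
  next
    fix t assume "t \<in> ?R"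
    then consider u where "t = [u @ x i, u @ z i]" "u \<in> P" | w where "t = [w, f w]" "w \<in> ?D I" by blast
    then show "t \<in> ?L"
    proof cases
      case 1
      then have "t = [u @ x i, g (u @ x i)]" by (simp add: g_def P_def)
      then show ?thesis using 1 by (auto simp: P_def)
    next
      case 2
      then have "t = [w, g w]" by (simp only: g_def if_True)
      then show ?thesis using 2 by auto
    qed
  qed
  then have "sync_regular {[w, g w] |w. w \<in> ?D (insert i I)}"
    using sync_regular_Un[OF sync_regular_common_prefix[OF P] reg] by simp
  moreover have "\<exists>j\<in>insert i I. \<exists>u\<in>Q j. w = u @ x j \<and> g w = u @ z j" if "w \<in> ?D (insert i I)" for w
  proof (cases "w \<in> ?D I")
    case True
    then have "g w = f w" by (simp only: g_def if_True)
    then show ?thesis using f True by (metis insertI2)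
  next
    case False
    then show ?thesis using that by (auto simp: g_def)
  qed
  ultimately show ?case by (intro exI[of _ g] conjI ballI)
qed

lemma regular_Domain:
  assumes "sync_regular (pairs_as_tuples R)" "length_nonincreasing R"
  shows "regular (Domain R)"
proof -
  have "map (\<lambda>c. the (c ! 0)) (pad [u, v]) = u" if "(u, v) \<in> R" for u v
    using assms(2) that by (intro map_fst_pad) (auto simp: length_nonincreasing_def)
  moreover have "pairs_as_tuples R = (\<lambda>(u, v). [u, v]) ` R" by (auto simp: pairs_as_tuples_def)
  ultimately have "map (\<lambda>c. the (c ! 0)) ` pad ` pairs_as_tuples R = Domain R"
    unfolding Domain_fst by (simp add: image_image case_prod_beta)
  moreover have "regular (map (\<lambda>c. the (c ! 0)) ` pad ` pairs_as_tuples R)"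
    using assms(1) unfolding sync_regular_def by (rule regular_map_image)
  ultimately show ?thesis by simp
qed

text \<open>For fixed \<open>x\<close> and \<open>z\<close>, the paddings of \<open>u\<close> with
  the first \<open>length u\<close> letters of \<open>v\<close> form a right quotient of the padded
  language, and projecting to the first component yields \<open>u\<close>. A word \<open>v\<close>
  shorter than \<open>u\<close> falls under \<open>z = []\<close>.\<close>

lemma regular_rule_prefixes:
  fixes R :: "('a list \<times> 'a list) set"
  assumes "sync_regular (pairs_as_tuples R)" "length_nonincreasing R"
  shows "regular {u. \<exists>v. (u @ x, v) \<in> R \<and> drop (length u) v = z}"
proof -
  let ?proj = "map (\<lambda>c. the (c ! 0)) :: 'a option list list \<Rightarrow> 'a list"
  let ?Q = "{q. q @ pad [x, z] \<in> pad ` pairs_as_tuples R}"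
  have len: "length v \<le> length u" if "(u, v) \<in> R" for u v
    using assms(2) that by (auto simp: length_nonincreasing_def)
  have "?proj ` ?Q = {u. \<exists>v. (u @ x, v) \<in> R \<and> drop (length u) v = z}"
  proof (intro equalityI subsetI)
    fix u assume "u \<in> {u. \<exists>v. (u @ x, v) \<in> R \<and> drop (length u) v = z}"
    then obtain v where v: "(u @ x, v) \<in> R" "drop (length u) v = z" by blast
    let ?v1 = "take (length u) v"
    have "pad [u @ x, ?v1 @ z] = pad [u, ?v1] @ pad [x, z]"
      using v(2) by (intro pad_pair_append) auto
    moreover have "?v1 @ z = v" unfolding v(2)[symmetric] by simp
    ultimately have "pad [u, ?v1] \<in> ?Q" using v(1) pad_pair_mem[of "u @ x" v R] by simp
    moreover have "?proj (pad [u, ?v1]) = u" by (intro map_fst_pad) simp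
    ultimately show "u \<in> ?proj ` ?Q" by (intro image_eqI[of _ _ "pad [u, ?v1]"]) simp_all
  next
    fix u assume "u \<in> ?proj ` ?Q"
    then obtain q where q: "u = ?proj q" "q @ pad [x, z] \<in> pad ` pairs_as_tuples R" by blast
    then obtain u' v' where r: "(u', v') \<in> R" "q @ pad [x, z] = pad [u', v']"
      by (auto simp: pairs_as_tuples_def)
    let ?n = "length q"
    have n: "?n \<le> length (pad [u', v'])" unfolding r(2)[symmetric] by simp
    have "q = take ?n (pad [u', v'])" "pad [x, z] = drop ?n (pad [u', v'])"
      unfolding r(2)[symmetric] by simp_all
    then have *: "q = pad [take ?n u', take ?n v']" "pad [x, z] = pad [drop ?n u', drop ?n v']"
      using take_pad[OF n] by simp_all
    have "u = take ?n u'"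
      unfolding q(1) by (subst *(1), intro map_fst_pad) (use len[OF r(1)] in simp)
    moreover have "?n \<le> length u'" using n len[OF r(1)] by (simp add: length_pad)
    moreover have "x = drop ?n u'" "z = drop ?n v'" using *(2) unfolding pad_pair_inj by simp_all
    ultimately have "(u @ x, v') \<in> R" "drop (length u) v' = z" using r(1) by simp_all
    then show "u \<in> {u. \<exists>v. (u @ x, v) \<in> R \<and> drop (length u) v = z}" by blast
  qed
  moreover have "regular (?proj ` ?Q)"
    using assms(1) unfolding sync_regular_def by (intro regular_map_image regular_rquot)
  ultimately show ?thesis by simp
qed

section \<open>Common prefixes of two words\<close>

lemma common_prefix_decomp:
  "\<exists>w s t. u = w @ s \<and> v = w @ t \<and> (s = [] \<or> t = [] \<or> hd s \<noteq> hd t)"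
proof (induction u arbitrary: v)
  case (Cons a u)
  show ?case
  proof (cases "v \<noteq> [] \<and> hd v = a")
    case True
    then obtain v' where v: "v = a # v'" by (cases v) auto
    obtain w s t where "u = w @ s" "v' = w @ t" "s = [] \<or> t = [] \<or> hd s \<noteq> hd t"
      using Cons.IH[of v'] by blast
    then have "a # u = (a # w) @ s \<and> v = (a # w) @ t \<and> (s = [] \<or> t = [] \<or> hd s \<noteq> hd t)"
      using v by simp
    then show ?thesis by blast
  next
    case False
    then have "a # u = [] @ (a # u) \<and> v = [] @ v \<and> (a # u = [] \<or> v = [] \<or> hd (a # u) \<noteq> hd v)"
      by auto
    then show ?thesis by blast
  qed
qed simp

lemma longest_common_prefix_append:
  assumes "s = [] \<or> t = [] \<or> hd s \<noteq> hd t"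
  shows "longest_common_prefix (w @ s) (w @ t) = w"
proof (induction w)
  case Nil
  then show ?case using assms by (cases s; cases t) auto
qed simp

lemma append_longer_prefix:
  assumes "p @ b # r = x @ v" "\<not> length p < length x"
  obtains p' where "p = x @ p'" "v = p' @ b # r"
proof -
  have "take (length x) (p @ b # r) = x" "drop (length x) (p @ b # r) = v"
    unfolding assms(1) by simp_all
  then have "take (length x) p = x" "drop (length x) p @ b # r = v" using assms(2) by simp_all
  then show thesis using append_take_drop_id[of "length x" p] by (intro that[of "drop (length x) p"]) simp_all
qed


section \<open>Normal forms of a length non-increasing prefix-rewriting system\<close>

locale prefix_system = group G for G :: "('a, 'm) monoid_scheme" (structure) +
  fixes A :: "'a set" and R :: "('a list \<times> 'a list) set"
  assumes finite_A: "finite A" and A_carrier: "A \<subseteq> carrier G"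
    and inv_A: "a \<in> A \<Longrightarrow> inv a \<in> A"
    and cprs: "cprs G A R" and len: "length_nonincreasing R"
begin

abbreviation "val \<equiv> word_value G"
abbreviation "N \<equiv> irreducibles A R"
abbreviation "nform \<equiv> nf G A R"

lemma A_closed [simp]: "a \<in> A \<Longrightarrow> a \<in> carrier G"
  using A_carrier by blast

lemma val_Nil [simp]: "val [] = \<one>"
  by (simp add: word_value_def)

lemma val_Cons [simp]: "val (a # w) = a \<otimes> val w"
  by (simp add: word_value_def)

lemma val_closed [simp]: "w \<in> lists A \<Longrightarrow> val w \<in> carrier G"
  by (induction w) auto

lemma val_append [simp]: "u \<in> lists A \<Longrightarrow> w \<in> lists A \<Longrightarrow> val (u @ w) = val u \<otimes> val w"
  by (induction u) (auto simp: m_assoc)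

lemma inv_word_in_lists [simp]: "w \<in> lists A \<Longrightarrow> inv_word G w \<in> lists A"
  by (auto simp: inv_word_def inv_A in_lists_conv_set)

lemma inv_word_Nil [simp]: "inv_word G [] = []"
  by (simp add: inv_word_def)

lemma inv_word_snoc [simp]: "inv_word G (w @ [a]) = inv a # inv_word G w"
  by (simp add: inv_word_def)

lemma length_inv_word [simp]: "length (inv_word G w) = length w"
  by (simp add: inv_word_def)

lemma val_inv_word [simp]: "w \<in> lists A \<Longrightarrow> val (inv_word G w) = inv (val w)"
  by (induction w rule: rev_induct) (auto simp: inv_A inv_mult_group)

lemma rule_lists: "(u, v) \<in> R \<Longrightarrow> u \<in> lists A \<and> v \<in> lists A"
  using cprs by (auto simp: cprs_def)

lemma rule_val: "(u, v) \<in> R \<Longrightarrow> val u = val v"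
proof -
  assume r: "(u, v) \<in> R"
  then have "([] @ u @ [], [] @ v @ []) \<in> monoid_rewrite A R" unfolding monoid_rewrite_def by blast
  then have "(u, v) \<in> monoid_congruence A R" by (auto simp: monoid_congruence_def)
  then show ?thesis using cprs rule_lists[OF r] by (auto simp: cprs_def monoid_presents_def)
qed

lemma rewrite_step:
  assumes "(w, w') \<in> prefix_rewrite A R"
  shows "w' \<in> lists A" "val w' = val w" "length w' \<le> length w"
proof -
  obtain u v y where r: "w = u @ y" "w' = v @ y" "(u, v) \<in> R" "y \<in> lists A"
    using assms by (auto simp: prefix_rewrite_def)
  moreover have "length v \<le> length u" using len r(3) by (auto simp: length_nonincreasing_def)
  ultimately show "w' \<in> lists A" "val w' = val w" "length w' \<le> length w"
    using rule_lists[OF r(3)] rule_val[OF r(3)] by simp_all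
qed

lemma no_infinite_rewriting: "wf {(w', w). w \<in> lists A \<and> (w, w') \<in> prefix_rewrite A R}"
  using cprs unfolding cprs_def wf_iff_no_infinite_down_chain by auto

text \<open>Rewriting is well-founded, and each step keeps the value and does not lengthen the word.
  The length bound is the source of the geodesic property of normal forms.\<close>

lemma irreducible_descendant:
  "w \<in> lists A \<Longrightarrow> \<exists>w'\<in>N. val w' = val w \<and> length w' \<le> length w"
proof (induction w rule: wf_induct_rule[OF no_infinite_rewriting])
  case (1 w)
  show ?case
  proof (cases "w \<in> N")
    case False
    then obtain w1 where w1: "(w, w1) \<in> prefix_rewrite A R" using 1 by (auto simp: irreducibles_def)
    then have "\<exists>w'\<in>N. val w' = val w1 \<and> length w' \<le> length w1"
      using 1 rewrite_step(1)[OF w1] by auto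
    then show ?thesis using rewrite_step(2,3)[OF w1] by fastforce
  qed auto
qed

lemma N_lists: "w \<in> N \<Longrightarrow> w \<in> lists A"
  by (simp add: irreducibles_def)

text \<open>A rule applicable to \<open>u\<close> is also applicable to \<open>u @ w\<close>. Being
  prefix-closed is what lets \<open>N\<close> be the set of path labels of a tree.\<close>

lemma N_prefix: "u @ w \<in> N \<Longrightarrow> u \<in> N"
proof -
  assume uw: "u @ w \<in> N"
  have "\<not> (u, u') \<in> prefix_rewrite A R" for u'
  proof
    assume "(u, u') \<in> prefix_rewrite A R"
    then obtain x v y where "u = x @ y" "(x, v) \<in> R" "y \<in> lists A"
      by (auto simp: prefix_rewrite_def)
    moreover have "u @ w \<in> lists A" using uw by (simp add: irreducibles_def)
    ultimately have "\<exists>x' v' y'. u @ w = x' @ y' \<and> v @ y @ w = v' @ y' \<and> (x', v') \<in> R \<and> y' \<in> lists A"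
      by (metis append_assoc append_in_lists_conv)
    then have "(u @ w, v @ y @ w) \<in> prefix_rewrite A R"
      unfolding prefix_rewrite_def by blast
    then show False using uw by (simp add: irreducibles_def)
  qed
  then show "u \<in> N" using uw by (simp add: irreducibles_def)
qed

lemma Nil_N [simp]: "[] \<in> N"
  using irreducible_descendant[of "[]"] by auto

lemma ex1_normal_form: "g \<in> carrier G \<Longrightarrow> \<exists>!w. w \<in> N \<and> val w = g"
  using cprs unfolding cprs_def by (elim conjE) (rule bspec)

lemma N_unique: "u \<in> N \<Longrightarrow> w \<in> N \<Longrightarrow> val u = val w \<Longrightarrow> u = w"
proof -
  assume *: "u \<in> N" "w \<in> N" "val u = val w"
  have "val w \<in> carrier G" using * N_lists by simp
  then have "\<exists>!x. x \<in> N \<and> val x = val w" by (rule ex1_normal_form)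
  then obtain x where x: "\<And>y. y \<in> N \<Longrightarrow> val y = val w \<Longrightarrow> y = x" by metis
  show "u = w" using x[OF *(1,3)] x[OF *(2) refl] by simp
qed

lemma nform:
  assumes "g \<in> carrier G"
  shows "nform g \<in> N" "val (nform g) = g"
proof -
  from theI'[OF ex1_normal_form[OF assms]] show "nform g \<in> N" "val (nform g) = g" by (auto simp: nf_def)
qed

lemma nform_lists [simp]: "g \<in> carrier G \<Longrightarrow> nform g \<in> lists A"
  by (rule N_lists[OF nform(1)])

lemma nform_eqI: "w \<in> N \<Longrightarrow> val w = g \<Longrightarrow> nform g = w"
proof -
  assume w: "w \<in> N" "val w = g"
  then have "g \<in> carrier G" using N_lists by auto
  from nform[OF this] show "nform g = w" using w by (intro N_unique) simp_all
qed

lemma nform_one [simp]: "nform \<one> = []"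
  by (rule nform_eqI) auto

lemma length_nform_le: "w \<in> lists A \<Longrightarrow> length (nform (val w)) \<le> length w"
proof -
  assume "w \<in> lists A"
  then obtain w' where w': "w' \<in> N" "val w' = val w" "length w' \<le> length w"
    using irreducible_descendant by blast
  show ?thesis using nform_eqI[OF w'(1,2)] w'(3) by simp
qed

lemma length_nform_mult_le:
  "g \<in> carrier G \<Longrightarrow> w \<in> lists A \<Longrightarrow> length (nform (g \<otimes> val w)) \<le> length (nform g) + length w"
  using length_nform_le[of "nform g @ w"] by (simp add: nform)

lemma length_nform_step: "g \<in> carrier G \<Longrightarrow> a \<in> A \<Longrightarrow> length (nform (g \<otimes> a)) \<le> length (nform g) + 1"
  using length_nform_mult_le[of g "[a]"] by simp

lemma length_nform_step_ge: "g \<in> carrier G \<Longrightarrow> a \<in> A \<Longrightarrow> length (nform g) \<le> length (nform (g \<otimes> a)) + 1"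
  using length_nform_step[of "g \<otimes> a" "inv a"] by (simp add: inv_A m_assoc)

text \<open>A rule can only apply at the end of a minimally reducible word, because its other prefixes
  are irreducible.\<close>

lemma minimally_reducible_rule:
  assumes "u \<in> minimally_reducible A R"
  obtains v where "(u, v) \<in> minimal_rules A R"
proof -
  obtain w l where u: "u = w @ [l]" "w \<in> N" "l \<in> A" "u \<notin> N"
    using assms by (auto simp: minimally_reducible_def)
  then have "u \<in> lists A" using N_lists by auto
  then obtain x v y where r: "(x, v) \<in> R" "u = x @ y" "y \<in> lists A"
    using u by (auto simp: irreducibles_def prefix_rewrite_def)
  have "y = []"
  proof (rule ccontr)
    assume "y \<noteq> []"
    then have "w = x @ butlast y" using r u by (metis butlast_append butlast_snoc)
    then have "x @ butlast y \<in> N" using u(2) by simp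
    moreover have "(x @ butlast y, v @ butlast y) \<in> prefix_rewrite A R"
      using r unfolding prefix_rewrite_def by (fastforce simp: in_lists_conv_set dest: in_set_butlastD)
    ultimately show False by (auto simp: irreducibles_def)
  qed
  with r assms have "(u, v) \<in> minimal_rules A R" by (simp add: minimal_rules_def)
  then show thesis by (rule that)
qed

lemma reducible_prefix:
  assumes "w \<in> lists A" "w \<notin> N"
  obtains u y where "w = u @ y" "u \<in> minimally_reducible A R"
proof -
  have "\<exists>u y. w = u @ y \<and> u \<in> minimally_reducible A R"
    using assms
  proof (induction w rule: rev_induct)
    case (snoc a w)
    show ?case
    proof (cases "w \<in> N")
      case True
      then have "w @ [a] \<in> minimally_reducible A R" using snoc by (auto simp: minimally_reducible_def)
      then show ?thesis by (metis append_Nil2)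
    next
      case False
      then obtain u y where "w = u @ y" "u \<in> minimally_reducible A R" using snoc by auto
      then show ?thesis by (metis append_assoc)
    qed
  qed simp
  then show thesis using that by blast
qed

text \<open>The shortest reducible prefix of a reducible word is minimally reducible, hence the
  left-hand side of a minimal rule.\<close>

lemma irreducibles_minimal_rules: "irreducibles A (minimal_rules A R) = N"
proof (intro equalityI subsetI)
  fix w assume "w \<in> N"
  moreover have "prefix_rewrite A (minimal_rules A R) \<subseteq> prefix_rewrite A R"
    by (auto simp: prefix_rewrite_def minimal_rules_def)
  ultimately show "w \<in> irreducibles A (minimal_rules A R)" by (auto simp: irreducibles_def)
next
  fix w assume w: "w \<in> irreducibles A (minimal_rules A R)"
  show "w \<in> N"
  proof (rule ccontr)
    assume "w \<notin> N"
    moreover have wl: "w \<in> lists A" using w by (simp add: irreducibles_def)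
    ultimately obtain u y where u: "w = u @ y" "u \<in> minimally_reducible A R"
      using reducible_prefix by blast
    obtain v where "(u, v) \<in> minimal_rules A R" using minimally_reducible_rule[OF u(2)] .
    then have "(w, v @ y) \<in> prefix_rewrite A (minimal_rules A R)"
      using u wl by (auto simp: prefix_rewrite_def)
    then show False using w by (auto simp: irreducibles_def)
  qed
qed

lemma nf_minimal_rules: "nf G A (minimal_rules A R) g = nform g"
  by (simp add: nf_def irreducibles_minimal_rules)


section \<open>The Cayley graph and the spanning tree\<close>

lemma cayley_simps [simp]:
  "verts (cayley G A) = carrier G" "arcs (cayley G A) = carrier G \<times> A"
  "tail (cayley G A) = fst" "head (cayley G A) e = fst e \<otimes> snd e"
  by (simp_all add: cayley_def case_prod_beta)

text \<open>The two alternatives are the arcs leading away from the identity and those leading back.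
  Their disjunction is the condition under which \<open>constructed_flow\<close> returns the edge
  itself.\<close>

definition tree_arcs :: "('a \<times> 'a) set" where
  "tree_arcs = {(y, a). y \<in> carrier G \<and> a \<in> A \<and>
     (nform y @ [a] \<in> N \<or> nform y \<noteq> [] \<and> last (nform y) = inv a)}"

definition tree :: "('a, 'a \<times> 'a) pre_digraph" where
  "tree = (cayley G A)\<lparr>arcs := tree_arcs\<rparr>"

lemma tree_simps [simp]:
  "verts tree = carrier G" "arcs tree = tree_arcs" "tail tree = fst" "head tree e = fst e \<otimes> snd e"
  by (simp_all add: tree_def)

lemma tree_arcs_subset: "tree_arcs \<subseteq> carrier G \<times> A"
  by (auto simp: tree_arcs_def)

lemma down_edge: "y \<in> carrier G \<Longrightarrow> nform y @ [a] \<in> N \<Longrightarrow> nform (y \<otimes> a) = nform y @ [a]"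
  using N_lists[of "nform y @ [a]"] by (intro nform_eqI) (auto simp: nform)

lemma up_edge:
  assumes "y \<in> carrier G" "nform y = w @ [inv a]" "a \<in> A"
  shows "nform (y \<otimes> a) = w"
proof (rule nform_eqI)
  have N: "w @ [inv a] \<in> N" using assms nform(1) by metis
  then show "w \<in> N" by (rule N_prefix)
  then have "val w \<otimes> inv a = y"
    using nform(2)[OF assms(1)] N_lists assms by (auto simp: inv_A)
  then show "val w = y \<otimes> a"
    using N_lists[OF \<open>w \<in> N\<close>] assms(3) by (simp add: m_assoc flip: \<open>val w \<otimes> inv a = y\<close>)
qed

lemma rev_tree_arc: "e \<in> tree_arcs \<Longrightarrow> rev_edge G e \<in> tree_arcs"
proof (cases e)
  case (Pair y a)
  assume "e \<in> tree_arcs"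
  then have ya: "y \<in> carrier G" "a \<in> A"
    and or: "nform y @ [a] \<in> N \<or> nform y \<noteq> [] \<and> last (nform y) = inv a"
    using Pair by (auto simp: tree_arcs_def)
  from or show ?thesis
  proof
    assume "nform y @ [a] \<in> N"
    then show ?thesis using ya Pair by (auto simp: tree_arcs_def rev_edge_def down_edge inv_A)
  next
    assume l: "nform y \<noteq> [] \<and> last (nform y) = inv a"
    then have "nform y = butlast (nform y) @ [inv a]" by (metis append_butlast_last_id)
    with up_edge[OF ya(1) this ya(2)] nform(1)[OF ya(1)] show ?thesis
      using ya Pair by (auto simp: tree_arcs_def rev_edge_def inv_A)
  qed
qed

section \<open>Walks in the Cayley graph and in the tree\<close>

lemma wf_cayley: "wf_digraph (cayley G A)"
  by unfold_locales auto

lemma wf_tree: "wf_digraph tree"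
  by unfold_locales (use tree_arcs_subset in auto)

lemma path_from_append:
  "y \<in> carrier G \<Longrightarrow> u \<in> lists A \<Longrightarrow> path_from G y (u @ w) = path_from G y u @ path_from G (y \<otimes> val u) w"
  by (induction u arbitrary: y) (auto simp: m_assoc)

lemma length_path_from [simp]: "length (path_from G y w) = length w"
  by (induction w arbitrary: y) auto

lemma path_label_path_from [simp]: "path_label (path_from G y w) = w"
  by (induction w arbitrary: y) (auto simp: path_label_def)

lemma set_path_from:
  "y \<in> carrier G \<Longrightarrow> w \<in> lists A \<Longrightarrow> e \<in> set (path_from G y w) \<Longrightarrow>
     \<exists>p b r. w = p @ b # r \<and> e = (y \<otimes> val p, b)"
proof (induction w arbitrary: y)
  case (Cons a w)
  show ?case
  proof (cases "e = (y, a)")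
    case True
    then show ?thesis using Cons.prems by (intro exI[of _ "[]"]) auto
  next
    case False
    then obtain p b r where "w = p @ b # r" "e = (y \<otimes> a \<otimes> val p, b)"
      using Cons.IH[of "y \<otimes> a"] Cons.prems by auto
    then show ?thesis using Cons.prems by (intro exI[of _ "a # p"]) (auto simp: m_assoc)
  qed
qed simp

lemma cayley_awalk_path_from:
  "y \<in> carrier G \<Longrightarrow> w \<in> lists A \<Longrightarrow> pre_digraph.awalk (cayley G A) y (path_from G y w) (y \<otimes> val w)"
proof (induction w arbitrary: y)
  case (Cons a w)
  then show ?case
    using Cons.IH[of "y \<otimes> a"] by (simp add: pre_digraph.awalk_def pre_digraph.cas.simps m_assoc)
qed (simp add: pre_digraph.awalk_def pre_digraph.cas.simps)

text \<open>Stated for a digraph \<open>D\<close> with the incidences of the Cayley graph, so that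
  it covers both the Cayley graph and \<open>tree\<close>.\<close>

lemma awalk_eq_path_from:
  assumes "pre_digraph.awalk D x p y" "tail D = fst" "\<And>e. head D e = fst e \<otimes> snd e"
    "arcs D \<subseteq> carrier G \<times> A" "verts D = carrier G"
  shows "p = path_from G x (map snd p) \<and> map snd p \<in> lists A \<and> y = x \<otimes> val (map snd p)"
  using assms(1)
proof (induction p arbitrary: x)
  case Nil
  then show ?case using assms by (auto simp: pre_digraph.awalk_def pre_digraph.cas.simps)
next
  case (Cons e p)
  obtain z a where e: "e = (z, a)" by (cases e)
  have *: "z = x" "x \<in> carrier G" "a \<in> A" "pre_digraph.awalk D (x \<otimes> a) p y"
    using Cons.prems assms e by (auto simp: pre_digraph.awalk_def pre_digraph.cas.simps)
  then show ?case using Cons.IH[of "x \<otimes> a"] e by (auto simp: m_assoc)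
qed

lemmas cayley_awalkD = awalk_eq_path_from[of "cayley G A", simplified]

lemma tree_awalkD:
  "pre_digraph.awalk tree x p y \<Longrightarrow>
     p = path_from G x (map snd p) \<and> map snd p \<in> lists A \<and> y = x \<otimes> val (map snd p)"
  by (rule awalk_eq_path_from) (use tree_arcs_subset in auto)

lemma cayley_dist_one: "g \<in> carrier G \<Longrightarrow> cayley_dist G A \<one> g = length (nform g)"
  unfolding cayley_dist_def
proof (rule Least_equality)
  assume g: "g \<in> carrier G"
  show "\<exists>p. pre_digraph.awalk (cayley G A) \<one> p g \<and> length p = length (nform g)"
    using cayley_awalk_path_from[of \<one> "nform g"] g nform[OF g]
    by (intro exI[of _ "path_from G \<one> (nform g)"]) auto
next
  fix n assume "g \<in> carrier G" "\<exists>p. pre_digraph.awalk (cayley G A) \<one> p g \<and> length p = n"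
  then obtain p where "pre_digraph.awalk (cayley G A) \<one> p g" "length p = n" by blast
  then show "length (nform g) \<le> n"
    using cayley_awalkD[of \<one> p g] length_nform_le[of "map snd p"] by auto
qed

lemma edge_height_eq:
  assumes "y \<in> carrier G" "a \<in> A"
  shows "edge_height G A (y, a) = (real (length (nform y)) + real (length (nform (y \<otimes> a)))) / 2"
  using assms by (simp add: edge_height_def cayley_dist_one)

lemma labels_geodesic_nform:
  assumes "g \<in> carrier G"
  shows "labels_geodesic G A (nform g)"
  unfolding labels_geodesic_def
  using cayley_awalk_path_from[of \<one> "nform g"] assms nform[OF assms] cayley_dist_one[OF assms]
  by (intro exI[of _ \<one>] exI[of _ "path_from G \<one> (nform g)"] exI[of _ g]) auto

lemma down_path:
  "y \<in> carrier G \<Longrightarrow> nform y @ w \<in> N \<Longrightarrow>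
     nform (y \<otimes> val w) = nform y @ w \<and> pre_digraph.awalk tree y (path_from G y w) (y \<otimes> val w)"
proof (induction w arbitrary: y)
  case Nil
  then show ?case by (auto simp: pre_digraph.awalk_def pre_digraph.cas.simps)
next
  case (Cons a w)
  have N: "nform y @ [a] \<in> N" using N_prefix[of "nform y @ [a]" w] Cons.prems by simp
  have a: "a \<in> A" "w \<in> lists A" using N_lists[OF Cons.prems(2)] by auto
  have "nform (y \<otimes> a) = nform y @ [a]" using down_edge N Cons.prems by simp
  moreover have "(y, a) \<in> tree_arcs" using N a Cons.prems by (auto simp: tree_arcs_def)
  ultimately show ?case
    using Cons.IH[of "y \<otimes> a"] Cons.prems a
    by (auto simp: pre_digraph.awalk_def pre_digraph.cas.simps m_assoc)
qed

text \<open>A backtrack would make \<open>nform y @ [a, inv a]\<close> irreducible with the same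
  value as \<open>nform y\<close>, against the uniqueness of normal forms.\<close>

lemma down_path_non_backtracking:
  "y \<in> carrier G \<Longrightarrow> nform y @ w \<in> N \<Longrightarrow> non_backtracking G (path_from G y w)"
proof (induction w arbitrary: y)
  case Nil
  then show ?case by (simp add: non_backtracking_def)
next
  case (Cons a w)
  have N: "nform y @ [a] \<in> N" using N_prefix[of "nform y @ [a]" w] Cons.prems by simp
  have a: "a \<in> A" "w \<in> lists A" using N_lists[OF Cons.prems(2)] by auto
  have d: "nform (y \<otimes> a) = nform y @ [a]" using down_edge N Cons.prems by simp
  have IH: "non_backtracking G (path_from G (y \<otimes> a) w)"
    using Cons.IH[of "y \<otimes> a"] Cons.prems a d by simp
  show ?case
  proof (cases w)
    case (Cons b w')
    have "b \<noteq> inv a"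
    proof
      assume b: "b = inv a"
      have "nform y @ [a, b] \<in> N"
        using N_prefix[of "nform y @ [a, b]" w'] Cons.prems Cons \<open>w = b # w'\<close> by simp
      moreover have "val (nform y @ [a, b]) = val (nform y)"
        using a b Cons.prems by (auto simp: inv_A)
      ultimately have "nform y @ [a, b] = nform y"
        using N_unique nform(1) Cons.prems by blast
      then show False by simp
    qed
    then show ?thesis using IH Cons by (simp add: non_backtracking_def rev_edge_def)
  qed (simp add: non_backtracking_def)
qed

lemma up_path:
  assumes "s \<in> lists A" "w @ s \<in> N"
  shows "pre_digraph.awalk tree (val (w @ s)) (path_from G (val (w @ s)) (inv_word G s)) (val w)"
  using assms
proof (induction s rule: rev_induct)
  case Nil
  then show ?case using N_lists by (auto simp: pre_digraph.awalk_def pre_digraph.cas.simps)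
next
  case (snoc a s)
  have w: "w \<in> lists A" "s \<in> lists A" "a \<in> A" using N_lists snoc.prems by fastforce+
  have N: "w @ s \<in> N" using N_prefix[of "w @ s" "[a]"] snoc.prems by simp
  have nfa: "nform (val (w @ s @ [a])) = w @ s @ [a]" using nform_eqI snoc.prems by simp
  then have "(val (w @ s @ [a]), inv a) \<in> tree_arcs"
    using w by (simp add: tree_arcs_def inv_A)
  moreover have "val (w @ s @ [a]) \<otimes> inv a = val (w @ s)"
    using w by (simp add: m_assoc)
  ultimately show ?case
    using snoc.IH[OF w(2) N] w
    by (auto simp: pre_digraph.awalk_def pre_digraph.cas.simps simp del: val_append)
qed

lemma non_backtracking_tl: "non_backtracking G (e # p) \<Longrightarrow> non_backtracking G p"
  by (cases p) (auto simp: non_backtracking_def)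

text \<open>The normal form of \<open>x \<otimes> a\<close> ends in \<open>a\<close>, so the only
  ascending arc there is the reverse of the one just taken. A walk that has descended once therefore
  keeps descending.\<close>

lemma non_backtracking_down:
  "pre_digraph.awalk tree x ((x, a) # p) y \<Longrightarrow> non_backtracking G ((x, a) # p) \<Longrightarrow>
     nform x @ [a] \<in> N \<Longrightarrow> nform y = nform x @ a # map snd p"
proof (induction p arbitrary: x a)
  case Nil
  then show ?case using down_edge by (auto simp: pre_digraph.awalk_def pre_digraph.cas.simps)
next
  case (Cons e p)
  obtain z b where e: "e = (z, b)" by (cases e)
  have *: "x \<in> carrier G" "a \<in> A" "z = x \<otimes> a" "b \<in> A" "(z, b) \<in> tree_arcs"
    and walk: "pre_digraph.awalk tree (x \<otimes> a) ((x \<otimes> a, b) # p) y"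
    using Cons.prems(1) e tree_arcs_subset
    by (auto simp: pre_digraph.awalk_def pre_digraph.cas.simps)
  have d: "nform (x \<otimes> a) = nform x @ [a]" using down_edge * Cons.prems by simp
  have "b \<noteq> inv a" using Cons.prems(2) e * by (auto simp: non_backtracking_def rev_edge_def)
  then have "a \<noteq> inv b" using * by auto
  then have "nform (x \<otimes> a) @ [b] \<in> N" using *(3,5) d by (auto simp: tree_arcs_def)
  moreover have "non_backtracking G ((x \<otimes> a, b) # p)"
    using non_backtracking_tl Cons.prems(2) e * by auto
  ultimately show ?case using Cons.IH[OF walk] d e by simp
qed

text \<open>A non-backtracking walk in the tree first ascends along \<open>r\<close> to the lowest common ancestor,
  whose normal form is \<open>w\<close>, and then descends along \<open>s\<close>.\<close>

lemma non_backtracking_up_down: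
  "pre_digraph.awalk tree x p y \<Longrightarrow> non_backtracking G p \<Longrightarrow>
     \<exists>w r s. nform x = w @ r \<and> nform y = w @ s \<and> map snd p = inv_word G r @ s \<and>
       (r = [] \<or> s = [] \<or> hd r \<noteq> hd s)"
proof (induction p arbitrary: x)
  case Nil
  then show ?case
    by (intro exI[of _ "nform x"] exI[of _ "[]"]) (simp add: pre_digraph.awalk_def pre_digraph.cas.simps)
next
  case (Cons e p)
  obtain z a where e: "e = (z, a)" by (cases e)
  have *: "x \<in> carrier G" "a \<in> A" "z = x" "(x, a) \<in> tree_arcs"
    and walk: "pre_digraph.awalk tree (x \<otimes> a) p y"
    using Cons.prems(1) e tree_arcs_subset
    by (auto simp: pre_digraph.awalk_def pre_digraph.cas.simps)
  show ?case
  proof (cases "nform x @ [a] \<in> N")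
    case True
    then have "nform y = nform x @ a # map snd p"
      using non_backtracking_down[of x a p y] Cons.prems e * by auto
    then show ?thesis
      using e by (intro exI[of _ "nform x"] exI[of _ "[]"] exI[of _ "a # map snd p"]) simp
  next
    case False
    then have "nform x \<noteq> []" "last (nform x) = inv a" using * by (auto simp: tree_arcs_def)
    then have nx: "nform x = butlast (nform x) @ [inv a]" by (metis append_butlast_last_id)
    then have up: "nform (x \<otimes> a) = butlast (nform x)" using up_edge * by blast
    obtain w r s where IH: "nform (x \<otimes> a) = w @ r" "nform y = w @ s"
      "map snd p = inv_word G r @ s" "r = [] \<or> s = [] \<or> hd r \<noteq> hd s"
      using Cons.IH[OF walk non_backtracking_tl[OF Cons.prems(2)]] by blast
    have "hd (r @ [inv a]) \<noteq> hd s" if "s \<noteq> []"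
    \<comment> \<open>If \<open>r = []\<close>, the walk turns right after \<open>e\<close>, and
      \<open>hd s = inv a\<close> would make its next arc the reverse of \<open>e\<close>.\<close>
    proof (cases "r = []")
      case True
      with IH that obtain b p' where p: "p = (x \<otimes> a, b) # p'" "hd s = b"
        using walk by (cases p) (auto simp: pre_digraph.awalk_def pre_digraph.cas.simps)
      then show ?thesis
        using Cons.prems(2) e * True by (auto simp: non_backtracking_def rev_edge_def)
    qed (use IH that in auto)
    moreover have "nform x = w @ r @ [inv a]" using nx up IH(1) by (metis append_assoc)
    ultimately have "nform x = w @ (r @ [inv a]) \<and> nform y = w @ s \<and>
        map snd (e # p) = inv_word G (r @ [inv a]) @ s \<and> (s = [] \<or> hd (r @ [inv a]) \<noteq> hd s)"
      using IH e * by auto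
    then show ?thesis by blast
  qed
qed

text \<open>From the identity the ascending part is empty, since \<open>nform \<one> = []\<close>.
  The equivalence lets the simplifier evaluate the \<open>THE\<close> in
  \<open>tree_nf\<close>.\<close>

lemma non_backtracking_from_one:
  "pre_digraph.awalk tree \<one> p g \<and> non_backtracking G p \<longleftrightarrow>
     g \<in> carrier G \<and> p = path_from G \<one> (nform g)"
proof (intro iffI; elim conjE)
  assume w: "pre_digraph.awalk tree \<one> p g" and n: "non_backtracking G p"
  note p = tree_awalkD[OF w]
  have "g \<in> carrier G" using conjunct2[OF p] by (elim conjE) (simp only: val_closed m_closed one_closed)
  moreover have "map snd p = nform g" using non_backtracking_up_down[OF w n] by auto
  ultimately show "g \<in> carrier G \<and> p = path_from G \<one> (nform g)" using conjunct1[OF p] by simp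
next
  assume "g \<in> carrier G" "p = path_from G \<one> (nform g)"
  then show "pre_digraph.awalk tree \<one> p g \<and> non_backtracking G p"
    using down_path[of \<one> "nform g"] down_path_non_backtracking[of \<one> "nform g"] nform by auto
qed

lemma tree_nf_eq: "g \<in> carrier G \<Longrightarrow> tree_nf G tree g = nform g"
  by (simp add: tree_nf_def non_backtracking_from_one)

lemma tree_labels_eq: "tree_labels G tree = N"
proof -
  have "tree_labels G tree = nform ` carrier G"
    unfolding tree_labels_def non_backtracking_from_one by (auto simp: image_iff) (metis path_label_path_from)
  also have "\<dots> = N"
  proof (intro equalityI subsetI)
    fix w assume "w \<in> N"
    then have "w = nform (val w)" "val w \<in> carrier G" using nform_eqI N_lists by simp_all
    then show "w \<in> nform ` carrier G" by (rule image_eqI)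
  qed (use nform(1) in auto)
  finally show ?thesis .
qed

lemma spanning_tree: "cayley_spanning_tree G A tree"
  unfolding cayley_spanning_tree_def
proof (intro conjI)
  have "tail (cayley G A) = tail tree" "head (cayley G A) = head tree" by auto
  then show "spanning tree (cayley G A)"
    using wf_cayley wf_tree tree_arcs_subset by (auto simp: spanning_def subgraph_def compatible_def)
  show "\<forall>e\<in>arcs tree. rev_edge G e \<in> arcs tree" using rev_tree_arc by simp
  interpret T: wf_digraph tree by (rule wf_tree)
  have from1: "\<one> \<rightarrow>\<^sup>*\<^bsub>tree\<^esub> g" if "g \<in> carrier G" for g
    using that non_backtracking_from_one by (auto simp: T.reachable_awalk)
  have to1: "g \<rightarrow>\<^sup>*\<^bsub>tree\<^esub> \<one>" if "g \<in> carrier G" for g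
    using up_path[of "nform g" "[]"] nform[OF that] that unfolding T.reachable_awalk by auto
  show "strongly_connected tree"
    unfolding strongly_connected_def
  proof (intro conjI ballI)
    fix u v assume "u \<in> verts tree" "v \<in> verts tree"
    then show "u \<rightarrow>\<^sup>*\<^bsub>tree\<^esub> v" using T.reachable_trans[OF to1 from1] by simp
  next
    show "verts tree \<noteq> {}" using one_closed unfolding tree_simps by blast
  qed
  show "\<not> (\<exists>p. pre_digraph.cycle tree p \<and> non_backtracking G p)"
  proof
    assume "\<exists>p. pre_digraph.cycle tree p \<and> non_backtracking G p"
    then obtain p u where w: "pre_digraph.awalk tree u p u" "p \<noteq> []" "non_backtracking G p"
      by (auto simp: T.cycle_def)
    obtain w r s where "nform u = w @ r" "nform u = w @ s" "map snd p = inv_word G r @ s"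
      "r = [] \<or> s = [] \<or> hd r \<noteq> hd s"
      using non_backtracking_up_down[OF w(1,3)] by blast
    \<comment> \<open>A closed walk ascends and descends along the same word, and a nonempty word
      cannot differ from itself in its first letter.\<close>
    then have "r = s" "s = []" by auto
    then show False using \<open>map snd p = inv_word G r @ s\<close> w(2) by simp
  qed
qed


section \<open>Regularity of the normal forms and of the minimal rules\<close>

lemma regular_N:
  assumes "sync_regular (pairs_as_tuples R)"
  shows "regular N"
proof -
  have "N = lists A - {x @ y |x y. x \<in> Domain R \<and> y \<in> lists A}"
    by (auto simp: irreducibles_def prefix_rewrite_def)
  then show ?thesis
    using regular_Diff[OF regular_lists[OF finite_A] regular_conc[OF regular_Domain[OF assms len] regular_lists[OF finite_A]]]
    by simp
qed

lemma minimal_rules_subset: "(u, v) \<in> minimal_rules A R \<Longrightarrow> (u, v) \<in> R \<and> u \<in> minimally_reducible A R"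
  by (simp add: minimal_rules_def)

lemma length_nonincreasing_minimal_rules: "length_nonincreasing (minimal_rules A R)"
  using len minimal_rules_subset unfolding length_nonincreasing_def by fast

lemma minimal_rule_length: "(u, v) \<in> minimal_rules A R \<Longrightarrow> length v \<le> length u"
  using length_nonincreasing_minimal_rules by (auto simp: length_nonincreasing_def)

text \<open>The minimal rules are cut out of \<open>R\<close> by a regular condition on the
  left-hand side, which the letterwise projection reads off the padding.\<close>

lemma sync_regular_minimal_rules:
  assumes "sync_regular (pairs_as_tuples R)"
  shows "sync_regular (pairs_as_tuples (minimal_rules A R))"
proof -
  let ?proj = "map (\<lambda>c. the (c ! 0)) :: 'a option list list \<Rightarrow> 'a list"
  let ?MR = "minimally_reducible A R"
  have N: "regular N" using assms by (rule regular_N)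
  have "?MR = {x @ y |x y. x \<in> N \<and> y \<in> (\<lambda>l. [l]) ` A} - N"
    by (auto simp: minimally_reducible_def)
  moreover have "regular {x @ y |x y. x \<in> N \<and> y \<in> (\<lambda>l. [l]) ` A}"
    by (rule regular_conc[OF N regular_finite[OF finite_imageI[OF finite_A]]])
  ultimately have "regular ?MR" using N regular_Diff by simp
  then have "regular {p \<in> pad ` pairs_as_tuples R. ?proj p \<in> ?MR}"
    using assms by (intro regular_map_vimage) (simp_all add: sync_regular_def)
  moreover have "?proj (pad [u, v]) = u" if "(u, v) \<in> R" for u v
    using len that by (intro map_fst_pad) (auto simp: length_nonincreasing_def)
  then have "{p \<in> pad ` pairs_as_tuples R. ?proj p \<in> ?MR} = pad ` pairs_as_tuples (minimal_rules A R)"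
    by (auto simp: pairs_as_tuples_def minimal_rules_def)
  ultimately show ?thesis by (simp add: sync_regular_def)
qed

lemma minimally_reducible_eq:
  "minimally_reducible A R = {nform y @ [a] |y a. y \<in> carrier G \<and> a \<in> A \<and> nform y @ [a] \<notin> N}"
proof (intro equalityI subsetI)
  fix u assume "u \<in> minimally_reducible A R"
  then obtain w a where w: "u = w @ [a]" "w \<in> N" "a \<in> A" "u \<notin> N"
    by (auto simp: minimally_reducible_def)
  then have "nform (val w) = w" "val w \<in> carrier G" using nform_eqI[OF w(2) refl] N_lists by simp_all
  then show "u \<in> {nform y @ [a] |y a. y \<in> carrier G \<and> a \<in> A \<and> nform y @ [a] \<notin> N}"
    using w by (intro CollectI exI[of _ "val w"] exI[of _ a]) simp
qed (auto simp: minimally_reducible_def nform)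

lemma minimally_reducible_lists: "u \<in> minimally_reducible A R \<Longrightarrow> u \<in> lists A"
  unfolding minimally_reducible_def using N_lists by fastforce


section \<open>Rules with bounded change\<close>

lemma mult_eq_imp_quotient_eq:
  assumes "a \<in> carrier G" "b \<in> carrier G" "c \<in> carrier G" "d \<in> carrier G" "a \<otimes> b = c \<otimes> d"
  shows "b \<otimes> inv d = inv a \<otimes> c"
proof -
  have "b = inv a \<otimes> (a \<otimes> b)" using assms(1,2) by (simp add: m_assoc[symmetric])
  then have "b = inv a \<otimes> (c \<otimes> d)" unfolding assms(5) .
  then show ?thesis using assms(1-4) by (simp add: m_assoc)
qed

text \<open>The value of \<open>z\<close> is \<open>inv (val u) \<otimes> val v1\<close> with
  \<open>v1 = take (length u) v\<close>, so it does not depend on how the rule continues after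
  \<open>u\<close> and \<open>v1\<close>. The continuation may be replaced by one that
  \<open>M\<close> reads in fewer steps than it has states, and then each of its two components has
  at most \<open>card (dfa_states M) - 1\<close> letters.\<close>

lemma pumped_suffix:
  assumes M: "is_dfa M" and lang: "dfa_lang M = pad ` pairs_as_tuples (minimal_rules A R)"
    and r: "(u @ x, v) \<in> minimal_rules A R"
    and z: "z = nform (val (x @ inv_word G (drop (length u) v)))"
  shows "length z \<le> 2 * card (dfa_states M) - 2" "z \<in> lists A"
    "val (u @ z) = val (take (length u) v)"
proof -
  let ?v1 = "take (length u) v" and ?v2 = "drop (length u) v"
  have ux: "u @ x \<in> lists A" and vA: "v \<in> lists A" and eq: "val (u @ x) = val v"
    using rule_lists rule_val minimal_rules_subset[OF r] by blast+
  then have A: "u \<in> lists A" "x \<in> lists A" "?v1 \<in> lists A" "?v2 \<in> lists A"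
    by (auto simp: in_lists_conv_set dest: in_set_takeD in_set_dropD)
  have "val v = val ?v1 \<otimes> val ?v2" using val_append[OF A(3,4)] by simp
  then have diff: "val (x @ inv_word G ?v2) = inv (val u) \<otimes> val ?v1"
    using eq A mult_eq_imp_quotient_eq[of "val u" "val x" "val ?v1" "val ?v2"] by simp
  have xv: "x @ inv_word G ?v2 \<in> lists A" using A by simp
  show zA: "z \<in> lists A" unfolding z by (intro nform_lists val_closed xv)
  have "val z = inv (val u) \<otimes> val ?v1"
    unfolding z diff[symmetric] by (rule nform(2)[OF val_closed[OF xv]])
  then show "val (u @ z) = val ?v1" using A zA by (simp add: m_assoc[symmetric])
  have pad: "pad [u @ x, v] = pad [u, ?v1] @ pad [x, ?v2]"
    using pad_pair_append[of ?v1 u ?v2 x] by fastforce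
  then have acc: "pad [u, ?v1] @ pad [x, ?v2] \<in> dfa_lang M"
    using r unfolding lang pad[symmetric] pad_pair_mem by simp
  let ?q = "foldl (dfa_trans M) (dfa_init M) (pad [u, ?v1])"
  have alph: "pad [u, ?v1] \<in> lists (dfa_alphabet M)" "pad [x, ?v2] \<in> lists (dfa_alphabet M)"
    using acc unfolding dfa_lang_def by auto
  have "?q \<in> dfa_states M" using M by (intro foldl_in_dfa_states[OF M _ alph(1)]) (simp add: is_dfa_def)
  moreover have "foldl (dfa_trans M) ?q (pad [x, ?v2]) \<in> dfa_final M"
    using acc by (simp add: dfa_lang_def)
  ultimately obtain p where p: "p \<in> lists (dfa_alphabet M)" "length p < card (dfa_states M)"
    "foldl (dfa_trans M) ?q p \<in> dfa_final M"
    using dfa_short_accepting_run[OF M _ alph(2)] by blast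
  then have "pad [u, ?v1] @ p \<in> dfa_lang M" using alph by (simp add: dfa_lang_def)
  then obtain u' v' where r': "pad [u, ?v1] @ p = pad [u', v']" "(u', v') \<in> minimal_rules A R"
    unfolding lang by (auto simp: pairs_as_tuples_def)
  \<comment> \<open>Unpadding both components identifies the new rule as
    \<open>(u @ ?x, ?v1 @ ?y)\<close>.\<close>
  let ?x = "unpad 0 p" and ?y = "unpad 1 p"
  have "u' = unpad 0 (pad [u', v'])" "v' = unpad 1 (pad [u', v'])" by (simp_all add: unpad_pad)
  then have uv': "u' = u @ ?x" "v' = ?v1 @ ?y"
    unfolding r'(1)[symmetric] unpad_append by (simp_all add: unpad_pad)
  have "(u', v') \<in> R" using r'(2) minimal_rules_subset by blast
  then have xy: "?x \<in> lists A" "?y \<in> lists A" "val u \<otimes> val ?x = val ?v1 \<otimes> val ?y"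
    using rule_lists[of u' v'] rule_val[of u' v'] A unfolding uv' by auto
  then have "inv (val u) \<otimes> val ?v1 = val (?x @ inv_word G ?y)"
    using A mult_eq_imp_quotient_eq[of "val u" "val ?x" "val ?v1" "val ?y"] by simp
  then have "z = nform (val (?x @ inv_word G ?y))" unfolding z diff by simp
  then have "length z \<le> length (?x @ inv_word G ?y)"
    using xy by (simp only: length_nform_le append_in_lists_conv inv_word_in_lists)
  also have "\<dots> \<le> 2 * card (dfa_states M) - 2"
    using length_unpad_le[of 0 p] length_unpad_le[of 1 p] p(2) by simp
  finally show "length z \<le> 2 * card (dfa_states M) - 2" .
qed

text \<open>In the long case \<open>x\<close> is the suffix \<open>u2 l\<close> of the paper.\<close>

lemma bounded_rule_cases:
  assumes "(u, c) \<in> bounded_rules G A R n"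
  obtains (short) "u \<in> minimally_reducible A R" "length u < n" "c = nform (val u)"
  | (long) u1 x v where "u = u1 @ x" "length x = n" "(u, v) \<in> minimal_rules A R"
      "c = u1 @ nform (val (x @ inv_word G (drop (length u1) v))) @ drop (length u1) v"
proof -
  from assms consider "(u, c) \<in> short_rules G A R n" | "(u, c) \<in> long_rules G A R n"
    by (auto simp: bounded_rules_def)
  then show thesis
  proof cases
    case 1
    then show thesis using short by (auto simp: short_rules_def nf_minimal_rules)
  next
    case 2
    then have "\<exists>u1 u2 l v v1 v2. u = u1 @ u2 @ [l] \<and>
      c = u1 @ nf G A (minimal_rules A R) (val (u2 @ [l] @ inv_word G v2)) @ v2 \<and>
      (u1 @ u2 @ [l], v) \<in> minimal_rules A R \<and> l \<in> A \<and> length u2 < n \<and> n \<le> length (u2 @ [l]) \<and>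
      v = v1 @ v2 \<and> v1 = take (length u1) v"
      unfolding long_rules_def mem_Collect_eq prod.inject conj_assoc .
    then obtain u1 u2 l v v1 v2 where *: "u = u1 @ u2 @ [l]"
      "c = u1 @ nf G A (minimal_rules A R) (val (u2 @ [l] @ inv_word G v2)) @ v2"
      "(u1 @ u2 @ [l], v) \<in> minimal_rules A R" "length u2 < n" "n \<le> length (u2 @ [l])"
      "v = v1 @ v2" "v1 = take (length u1) v"
      by (elim exE conjE) (rule that)
    have "v1 @ v2 = take (length u1) v @ drop (length u1) v"
      unfolding append_take_drop_id by (rule *(6)[symmetric])
    then have "v2 = drop (length u1) v" unfolding *(7)[symmetric] by simp
    then show thesis using *(1-5) by (intro long[of u1 "u2 @ [l]" v]) (simp_all add: nf_minimal_rules)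
  qed
qed

context
  fixes M :: "('s, 'a option list) dfa"
  assumes M: "is_dfa M" and lang: "dfa_lang M = pad ` pairs_as_tuples (minimal_rules A R)"
begin

text \<open>The bound that the construction calls N; here \<open>N\<close> already denotes the
  irreducible words.\<close>

abbreviation "K \<equiv> 2 * card (dfa_states M)"

text \<open>A short rule replaces its whole left-hand side, which has fewer than \<open>K\<close>
  letters. A long rule replaces a suffix of length \<open>K\<close> by the pumped word, of length at
  most \<open>K - 2\<close>, followed by the end of \<open>v\<close>, of length at most
  \<open>K\<close>.\<close>

lemma bounded_rule:
  assumes "(u, c) \<in> bounded_rules G A R K"
  shows "u \<in> minimally_reducible A R" "c \<in> lists A" "val c = val u"
    "\<exists>w x z. u = w @ x \<and> c = w @ z \<and> x \<noteq> [] \<and> length x \<le> K \<and> length z \<le> 2 * K"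
proof -
  have "u \<in> minimally_reducible A R \<and> c \<in> lists A \<and> val c = val u \<and>
    (\<exists>w x z. u = w @ x \<and> c = w @ z \<and> x \<noteq> [] \<and> length x \<le> K \<and> length z \<le> 2 * K)" (is ?P)
    using assms
  proof (cases rule: bounded_rule_cases)
    case short
    have u: "u \<in> lists A" using minimally_reducible_lists short by blast
    then have "length c \<le> length u" "c \<in> lists A" "val c = val u"
      unfolding short(3) using length_nform_le nform(2) by simp_all
    moreover have "u \<noteq> []" using short(1) by (auto simp: minimally_reducible_def)
    ultimately have "u = [] @ u \<and> c = [] @ c \<and> u \<noteq> [] \<and> length u \<le> K \<and> length c \<le> 2 * K"
      using short(2) by simp
    then have "\<exists>w x z. u = w @ x \<and> c = w @ z \<and> x \<noteq> [] \<and> length x \<le> K \<and> length z \<le> 2 * K"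
      by blast
    then show ?P using short \<open>c \<in> lists A\<close> \<open>val c = val u\<close> by blast
  next
    case (long u1 x v)
    let ?v1 = "take (length u1) v" and ?v2 = "drop (length u1) v"
    let ?z = "nform (val (x @ inv_word G ?v2))"
    have r: "(u1 @ x, v) \<in> minimal_rules A R" using long by simp
    note z = pumped_suffix[OF M lang r refl]
    have ux: "u1 @ x \<in> lists A" and vA: "v \<in> lists A" and eq: "val (u1 @ x) = val v"
      using rule_lists rule_val minimal_rules_subset[OF r] by blast+
    then have A: "u1 \<in> lists A" "?v1 \<in> lists A" "?v2 \<in> lists A"
      by (auto simp: in_lists_conv_set dest: in_set_takeD in_set_dropD)
    have c: "c = (u1 @ ?z) @ ?v2" using long(4) by simp
    have cA: "c \<in> lists A" unfolding c using A z(2) by simp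
    have "val c = val (u1 @ ?z) \<otimes> val ?v2" unfolding c using A z(2) by (intro val_append) simp_all
    also have "\<dots> = val u" unfolding z(3) using val_append[OF A(2,3)] eq long(1) by simp
    finally have vc: "val c = val u" .
    have "length v \<le> length u1 + K" using minimal_rule_length[OF r] long(2) by simp
    then have "length (?z @ ?v2) \<le> 2 * K" using z(1) by simp
    moreover have "x \<noteq> []" using long(2) dfa_card_pos[OF M] by auto
    ultimately have "u = u1 @ x \<and> c = u1 @ ?z @ ?v2 \<and> x \<noteq> [] \<and> length x \<le> K \<and> length (?z @ ?v2) \<le> 2 * K"
      using long(1,2) c by simp
    then have "\<exists>w x z. u = w @ x \<and> c = w @ z \<and> x \<noteq> [] \<and> length x \<le> K \<and> length z \<le> 2 * K"
      by blast
    moreover have "u \<in> minimally_reducible A R" using minimal_rules_subset long(3) by blast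
    ultimately show ?P using cA vc by blast
  qed
  then show "u \<in> minimally_reducible A R" "c \<in> lists A" "val c = val u"
    "\<exists>w x z. u = w @ x \<and> c = w @ z \<and> x \<noteq> [] \<and> length x \<le> K \<and> length z \<le> 2 * K"
    by blast+
qed

lemma regular_choice_exists:
  assumes "sync_regular (pairs_as_tuples R)"
  shows "\<exists>c. regular_rule_choice G A R K c"
proof -
  let ?MR = "minimally_reducible A R"
  \<comment> \<open>An index consists of the replaced suffix \<open>x\<close> and the end
    \<open>v2\<close> of the right-hand side of the minimal rule. It determines the replacement
    \<open>Z\<close>, and \<open>Q\<close> collects the prefixes to which it may be applied. If
    \<open>length x < K\<close>, then \<open>x\<close> is the whole left-hand side and the prefix is
    empty.\<close>
  define I where "I = {x. set x \<subseteq> A \<and> length x \<le> K} \<times> {x. set x \<subseteq> A \<and> length x \<le> K}"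
  define Z where "Z = (\<lambda>(x, v2). if length x < K then nform (val x) else nform (val (x @ inv_word G v2)) @ v2)"
  define Q where "Q = (\<lambda>(x, v2). if length x < K then (if x \<in> ?MR then {[]} else {})
      else {u. \<exists>v. (u @ x, v) \<in> minimal_rules A R \<and> drop (length u) v = v2})"
  have finI: "finite I" unfolding I_def using finite_lists_length_le[OF finite_A] by simp
  have "regular (Q i)" for i
    using regular_rule_prefixes[OF sync_regular_minimal_rules[OF assms] length_nonincreasing_minimal_rules]
    by (cases i) (simp add: Q_def regular_singleton regular_empty)
  then obtain f where
    f: "\<forall>w\<in>(\<Union>i\<in>I. (\<lambda>u. u @ fst i) ` Q i). \<exists>i\<in>I. \<exists>u\<in>Q i. w = u @ fst i \<and> f w = u @ Z i"
    and reg: "sync_regular {[w, f w] |w. w \<in> (\<Union>i\<in>I. (\<lambda>u. u @ fst i) ` Q i)}"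
    using regular_selection[OF finI, of Q fst Z] by blast
  have bounded: "(u @ fst i, u @ Z i) \<in> bounded_rules G A R K" if i: "i \<in> I" "u \<in> Q i" for i u
  proof -
    obtain x v2 where i': "i = (x, v2)" by (cases i)
    show ?thesis
    proof (cases "length x < K")
      case True
      then have "u = []" "x \<in> ?MR" using i(2) i' by (auto simp: Q_def split: if_splits)
      then show ?thesis using True i' by (auto simp: Z_def bounded_rules_def short_rules_def nf_minimal_rules)
    next
      case False
      then have lx: "length x = K" using i i' by (simp add: I_def)
      then have "x \<noteq> []" using dfa_card_pos[OF M] by auto
      then obtain u2 l where x: "x = u2 @ [l]" by (metis rev_exhaust)
      moreover have "set x \<subseteq> A" using i i' by (simp add: I_def)
      ultimately have l: "l \<in> A" by simp
      obtain v where v: "(u @ x, v) \<in> minimal_rules A R" "drop (length u) v = v2"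
        using i(2) i' False by (auto simp: Q_def)
      have split: "take (length u) v @ v2 = v" unfolding v(2)[symmetric] by simp
      have Z: "Z i = nf G A (minimal_rules A R) (val (u2 @ [l] @ inv_word G v2)) @ v2"
        using False i' x by (simp add: Z_def nf_minimal_rules)
      have "(u @ x, u @ Z i) \<in> long_rules G A R K"
        unfolding long_rules_def Z
        by (rule CollectI, rule exI[of _ u], rule exI[of _ u2], rule exI[of _ l], rule exI[of _ v],
            rule exI[of _ "take (length u) v"], rule exI[of _ v2], intro conjI)
          (use x l v(1) lx split in simp_all)
      then show ?thesis using i' by (simp add: bounded_rules_def)
    qed
  qed
  have "?MR \<subseteq> (\<Union>i\<in>I. (\<lambda>u. u @ fst i) ` Q i)"
  proof
    fix u assume u: "u \<in> ?MR"
    then have uA: "set u \<subseteq> A" using minimally_reducible_lists[OF u] by auto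
    show "u \<in> (\<Union>i\<in>I. (\<lambda>u. u @ fst i) ` Q i)"
    proof (cases "length u < K")
      case True
      then have "(u, []) \<in> I" "[] \<in> Q (u, [])" using u uA by (auto simp: I_def Q_def)
      then show ?thesis by (intro UN_I[of "(u, [])"] image_eqI[of _ _ "[]"]) simp_all
    next
      case False
      obtain v where v: "(u, v) \<in> minimal_rules A R" using minimally_reducible_rule[OF u] .
      let ?u = "take (length u - K) u" and ?x = "drop (length u - K) u"
      let ?v2 = "drop (length ?u) v"
      have x: "length ?x = K" "length ?u = length u - K" using False by simp_all
      have vA: "set v \<subseteq> A" using v rule_lists minimal_rules_subset by blast
      have "length ?v2 \<le> K" using minimal_rule_length[OF v] x by simp
      then have "(?x, ?v2) \<in> I" using x(1) uA vA by (auto simp: I_def dest: in_set_dropD)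
      moreover have "?u \<in> Q (?x, ?v2)" using v x by (auto simp: Q_def)
      ultimately show ?thesis by (intro UN_I[of "(?x, ?v2)"] image_eqI[of _ _ ?u]) simp_all
    qed
  qed
  moreover have "(\<Union>i\<in>I. (\<lambda>u. u @ fst i) ` Q i) \<subseteq> ?MR" using bounded bounded_rule(1) by blast
  ultimately have D: "(\<Union>i\<in>I. (\<lambda>u. u @ fst i) ` Q i) = ?MR" by blast
  define c where "c y a = f (nform y @ [a])" for y a
  have "(w, f w) \<in> bounded_rules G A R K" if "w \<in> ?MR" for w
    using f bounded that unfolding D by metis
  moreover have "{[w, f w] |w. w \<in> ?MR} = {[nform y @ [a], c y a] |y a.
      y \<in> carrier G \<and> a \<in> A \<and> nform y @ [a] \<notin> N}"
    unfolding minimally_reducible_eq c_def by blast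
  ultimately have "regular_rule_choice G A R K c"
    using reg unfolding regular_rule_choice_def D minimally_reducible_eq c_def by auto
  then show ?thesis by blast
qed


section \<open>The flow function\<close>

text \<open>The endpoints are represented by \<open>p\<close> and \<open>p @ [b]\<close>, and the
  height averages their distances. Together with \<open>edge_height_ge\<close> this settles every
  edge for which \<open>p\<close> has at most \<open>length (nform y) - 2\<close> letters.\<close>

lemma edge_height_le:
  assumes "p \<in> lists A" "b \<in> A"
  shows "edge_height G A (val p, b) \<le> real (length p) + 1 / 2"
  using edge_height_eq[of "val p" b] length_nform_le[of p] length_nform_le[of "p @ [b]"] assms by simp

lemma edge_height_ge:
  assumes "y \<in> carrier G" "a \<in> A"
  shows "real (length (nform y)) - 1 / 2 \<le> edge_height G A (y, a)"
  using edge_height_eq[OF assms] length_nform_step_ge[OF assms] by simp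

context
  fixes c :: "'a \<Rightarrow> 'a \<Rightarrow> 'a list"
  assumes end_normal: "end_normal G A R" and choice: "regular_rule_choice G A R K c"
begin

text \<open>By end-normality the normal form of the right-hand side ends in \<open>b\<close>.
  Without this letter it is still irreducible, and by cancellation its value is that of
  \<open>q\<close>. So the last edge of the path labeled by the right-hand side lies in the
  tree.\<close>

lemma end_normal_last_edge:
  assumes r: "(u, q @ [b]) \<in> minimal_rules A R"
  shows "nform (val (q @ [b])) = nform (val q) @ [b]"
proof -
  let ?v = "q @ [b]"
  have R: "(u, ?v) \<in> R" "u \<in> minimally_reducible A R" using minimal_rules_subset[OF r] by auto
  then obtain w l where "u = w @ [l]" "w \<in> N" "l \<in> A" by (auto simp: minimally_reducible_def)
  then have "same_last ?v (nform (val ?v))"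
    using end_normal R(1) unfolding end_normal_def by blast
  then have "nform (val ?v) \<noteq> []" "last (nform (val ?v)) = b" by (simp_all add: same_last_def)
  then obtain w' where w': "nform (val ?v) = w' @ [b]" by (metis append_butlast_last_id)
  have vA: "?v \<in> lists A" using rule_lists[OF R(1)] by blast
  then have qb: "q \<in> lists A" "b \<in> A" by auto
  have N: "w' @ [b] \<in> N" using nform(1)[OF val_closed[OF vA]] unfolding w' .
  then have w'N: "w' \<in> N" by (rule N_prefix)
  have "val (w' @ [b]) = val ?v" using nform(2)[OF val_closed[OF vA]] unfolding w' .
  then have "val w' = val q" using qb N_lists[OF w'N] by simp
  then show ?thesis using nform_eqI[OF w'N] w' by simp
qed

lemma choice_rule:
  "y \<in> carrier G \<Longrightarrow> a \<in> A \<Longrightarrow> nform y @ [a] \<notin> N \<Longrightarrow> (nform y @ [a], c y a) \<in> bounded_rules G A R K"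
  using choice unfolding regular_rule_choice_def by blast

lemma choice_rule_facts:
  assumes "y \<in> carrier G" "a \<in> A" "nform y @ [a] \<notin> N"
  shows "c y a \<in> lists A" "val (c y a) = y \<otimes> a"
    "\<exists>w x z. nform y @ [a] = w @ x \<and> c y a = w @ z \<and> x \<noteq> [] \<and> length x \<le> K \<and> length z \<le> 2 * K"
  using bounded_rule(2-4)[OF choice_rule[OF assms]] assms by (simp_all add: nform)

lemma chosen_rule_edge_height:
  assumes y: "y \<in> carrier G" and a: "a \<in> A" and red: "nform y @ [a] \<notin> N"
    and e': "e' \<in> set (path_from G \<one> (c y a))" "e' \<notin> tree_arcs"
  shows "edge_height G A e' < edge_height G A (y, a)"
proof -
  have cA: "c y a \<in> lists A" using choice_rule_facts(1)[OF y a red] .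
  obtain p b r where p: "c y a = p @ b # r" "e' = (\<one> \<otimes> val p, b)"
    using set_path_from[OF one_closed cA e'(1)] by blast
  have pA: "p \<in> lists A" "b \<in> A" using cA unfolding p(1) by auto
  have e'_eq: "e' = (val p, b)" using p(2) pA by simp
  let ?n = "length (nform y)"
  note lower = edge_height_ge[OF y a]
  from choice_rule[OF y a red] show ?thesis
  proof (cases rule: bounded_rule_cases)
    case short
    \<comment> \<open>The right-hand side of a short rule is a normal form, so its path runs inside
      the tree.\<close>
    then have "p @ b # r \<in> N" using p(1) nform(1) y a by (auto simp: nform)
    then have N: "p @ [b] \<in> N" using N_prefix[of "p @ [b]" r] by simp
    have "nform (val p) = p" by (rule nform_eqI[OF N_prefix[OF N] refl])
    then have "e' \<in> tree_arcs" using N pA unfolding e'_eq tree_arcs_def by simp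
    then show ?thesis using e'(2) by blast
  next
    case (long u1 x v)
    let ?v1 = "take (length u1) v" and ?v2 = "drop (length u1) v"
    let ?z = "nform (val (x @ inv_word G ?v2))"
    have rule: "(u1 @ x, v) \<in> minimal_rules A R" using long by simp
    note z = pumped_suffix[OF M lang rule refl]
    have n: "?n + 1 = length u1 + K" using long(1,2) by (metis length_append length_append_singleton Suc_eq_plus1)
    have K: "2 \<le> K" using dfa_card_pos[OF M] by simp
    have vA: "v \<in> lists A" and eq: "val (nform y @ [a]) = val v"
      using rule_lists rule_val minimal_rules_subset[OF long(3)] by blast+
    have ya: "val v = y \<otimes> a" using eq y a by (simp add: nform)
    have c: "p @ b # r = (u1 @ ?z) @ ?v2" using long(4) p(1) by simp
    \<comment> \<open>As \<open>?n + 1 = length u1 + K\<close> and \<open>?z\<close> has at most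
      \<open>K - 2\<close> letters, every edge within \<open>u1 @ ?z\<close> is preceded by at most
      \<open>?n - 2\<close> letters.\<close>
    have lz: "length (u1 @ ?z) + 1 \<le> ?n" using n z(1) K by simp
    show ?thesis
    proof (cases "length p < length (u1 @ ?z)")
      case True
      then have "edge_height G A e' \<le> real ?n - 3 / 2"
        using edge_height_le[OF pA] lz unfolding e'_eq by linarith
      then show ?thesis using lower by linarith
    next
      case False
      then obtain p' where p': "p = (u1 @ ?z) @ p'" "?v2 = p' @ b # r"
        by (rule append_longer_prefix[OF c])
      \<comment> \<open>Since \<open>u1 @ ?z\<close> and \<open>?v1\<close> have the same value, the
        edge also lies on the path from the identity labeled by \<open>v\<close>, where
        \<open>q\<close> is the part of \<open>v\<close> before it.\<close>
      define q where "q = ?v1 @ p'"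
      have "v = ?v1 @ ?v2" by simp
      then have v: "v = q @ b # r" unfolding p'(2) q_def by (simp only: append_assoc)
      have A: "?v1 \<in> lists A" "p' \<in> lists A" "u1 @ ?z \<in> lists A" using vA pA unfolding p'(1)
        by (auto simp: in_lists_conv_set dest: in_set_takeD)
      have "val p = val (u1 @ ?z) \<otimes> val p'" unfolding p'(1) using A by (intro val_append)
      also have "\<dots> = val q" unfolding z(3) q_def using A by simp
      finally have e'q: "e' = (val q, b)" unfolding e'_eq by simp
      have qA: "q \<in> lists A" "b \<in> A" "r \<in> lists A" using vA unfolding v by auto
      have lv: "length v \<le> ?n + 1" using minimal_rule_length[OF long(3)] by simp
      show ?thesis
      proof (cases r rule: rev_exhaust)
        case Nil
        then have "(nform y @ [a], q @ [b]) \<in> minimal_rules A R" using long(3) v by simp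
        from end_normal_last_edge[OF this] have "nform (val q) @ [b] \<in> N"
          using nform(1)[of "val (q @ [b])"] qA by simp
        then have "e' \<in> tree_arcs" using qA unfolding e'q tree_arcs_def by simp
        then show ?thesis using e'(2) by blast
      next
        case (snoc r' b')
        then have "(nform y @ [a], (q @ b # r') @ [b']) \<in> minimal_rules A R" using long(3) v by simp
        from end_normal_last_edge[OF this]
        have last: "nform (y \<otimes> a) = nform (val (q @ b # r')) @ [b']"
          using v snoc ya by simp
        have lq: "length q + length r' + 1 \<le> ?n" using lv v snoc by simp
        show ?thesis
        proof (cases "r' = []")
          \<comment> \<open>This is the last edge but one. It ends one step closer to the identity
            than \<open>y \<otimes> a\<close> and starts at least one step closer than
            \<open>y\<close>, so its height is smaller by at least 1.\<close>
          case True
          then have "length (nform (val q \<otimes> b)) + 1 = length (nform (y \<otimes> a))"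
            using last qA by simp
          moreover have "length (nform (val q)) + 1 \<le> ?n"
            using length_nform_le[OF qA(1)] lq by simp
          ultimately show ?thesis
            using edge_height_eq[OF y a] edge_height_eq[of "val q" b] qA unfolding e'q by simp
        next
          case False
          \<comment> \<open>At least two letters follow \<open>b\<close> in \<open>v\<close>, which
            has at most \<open>?n + 1\<close> letters.\<close>
          then have "length q + 2 \<le> ?n" using lq by (cases r') auto
          then have "edge_height G A e' \<le> real ?n - 3 / 2"
            using edge_height_le[OF qA(1,2)] unfolding e'q by linarith
          then show ?thesis using lower by linarith
        qed
      qed
    qed
  qed
qed

section \<open>Paths, bounds, termination and regularity of the flow\<close>

abbreviation "\<Phi> \<equiv> constructed_flow G A R c"

lemma flow_tree: "e \<in> tree_arcs \<Longrightarrow> \<Phi> e = [e]"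
  by (auto simp: constructed_flow_def tree_arcs_def Let_def)

lemma flow_split:
  assumes "c y a = w @ t" "nform y = w @ s" "s = [] \<or> t = [] \<or> hd s \<noteq> hd t"
    and "y \<in> carrier G" "a \<in> A" "(y, a) \<notin> tree_arcs"
  shows "\<Phi> (y, a) = path_from G y (inv_word G s @ t)"
proof -
  have "\<not> (nform y @ [a] \<in> N \<or> nform y \<noteq> [] \<and> last (nform y) = inv a)"
    using assms(4-6) by (simp add: tree_arcs_def)
  then show ?thesis
    unfolding constructed_flow_def prod.case Let_def
    by (simp only: if_False assms(1,2) longest_common_prefix_append[OF assms(3)]) simp
qed

lemma flow_cases:
  assumes e: "y \<in> carrier G" "a \<in> A" "(y, a) \<notin> tree_arcs"
  obtains w s t where "nform y = w @ s" "c y a = w @ t" "s = [] \<or> t = [] \<or> hd s \<noteq> hd t"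
    "\<Phi> (y, a) = path_from G y (inv_word G s @ t)" "nform y @ [a] \<notin> N"
    "length s \<le> K" "length t \<le> 2 * K" "w \<in> lists A" "s \<in> lists A" "t \<in> lists A"
proof -
  have red: "nform y @ [a] \<notin> N" using e by (simp add: tree_arcs_def)
  obtain w s t where w: "nform y = w @ s" "c y a = w @ t" "s = [] \<or> t = [] \<or> hd s \<noteq> hd t"
    using common_prefix_decomp[of "nform y" "c y a"] by blast
  obtain u x z where u: "nform y @ [a] = u @ x" "c y a = u @ z" "x \<noteq> []" "length x \<le> K" "length z \<le> 2 * K"
    using choice_rule_facts(3)[OF e(1,2) red] by blast
  \<comment> \<open>As \<open>x\<close> is nonempty, it absorbs the letter \<open>a\<close>, and
    \<open>u\<close> is a common prefix of \<open>nform y\<close> and \<open>c y a\<close>. The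
    longest one, \<open>w\<close>, is at least as long as \<open>u\<close>, so the bounds on
    \<open>x\<close> and \<open>z\<close> pass to \<open>s\<close> and \<open>t\<close>.\<close>
  have "nform y = u @ butlast x" using u(1,3) by (metis butlast_append butlast_snoc)
  then have "prefix u (longest_common_prefix (nform y) (c y a))"
    using u(2) by (intro longest_common_prefix_max_prefix) auto
  then have "prefix u w" unfolding w(1,2) longest_common_prefix_append[OF w(3)] .
  then have "length u \<le> length w" by (rule prefix_length_le)
  moreover have "length w + length s + 1 = length u + length x"
    using w(1) u(1) by (metis length_append length_append_singleton Suc_eq_plus1)
  moreover have "length w + length t = length u + length z"
    using w(2) u(2) by (metis length_append)
  ultimately have "length s \<le> K" "length t \<le> 2 * K" using u(4,5) by linarith+
  moreover have "w @ s \<in> lists A" "w @ t \<in> lists A"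
    using nform_lists[OF e(1)] choice_rule_facts(1)[OF e(1,2) red] unfolding w(1,2) by blast+
  ultimately show thesis
    using that[OF w flow_split[OF w(2,1,3) e] red] by simp
qed

lemma flow_awalk:
  assumes "y \<in> carrier G" "a \<in> A"
  shows "pre_digraph.awalk (cayley G A) y (\<Phi> (y, a)) (y \<otimes> a)"
proof (cases "(y, a) \<in> tree_arcs")
  case True
  then show ?thesis
    using assms by (simp add: flow_tree pre_digraph.awalk_def pre_digraph.cas.simps)
next
  case False
  then obtain w s t where w: "nform y = w @ s" "c y a = w @ t" "\<Phi> (y, a) = path_from G y (inv_word G s @ t)"
    "nform y @ [a] \<notin> N" and A: "w \<in> lists A" "s \<in> lists A" "t \<in> lists A"
    using flow_cases[OF assms] by metis
  have "y = val w \<otimes> val s" using nform(2)[OF assms(1)] A unfolding w(1) by simp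
  moreover have "y \<otimes> a = val w \<otimes> val t"
    using choice_rule_facts(2)[OF assms w(4)] A unfolding w(2) by simp
  ultimately have "y \<otimes> val (inv_word G s @ t) = y \<otimes> a"
    using A by (simp add: m_assoc[symmetric]) (simp add: m_assoc)
  then show ?thesis
    using cayley_awalk_path_from[of y "inv_word G s @ t"] assms A unfolding w(3) by simp
qed

lemma flow_length:
  assumes "y \<in> carrier G" "a \<in> A"
  shows "length (\<Phi> (y, a)) \<le> 3 * K + 1"
proof (cases "(y, a) \<in> tree_arcs")
  case False
  then show ?thesis by (rule flow_cases[OF assms]) simp
qed (simp add: flow_tree)

lemma flow_edge_height:
  assumes e: "y \<in> carrier G" "a \<in> A" "(y, a) \<notin> tree_arcs" and e': "e' \<in> set (\<Phi> (y, a))" "e' \<notin> tree_arcs"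
  shows "edge_height G A e' < edge_height G A (y, a)"
proof -
  obtain w s t where w: "nform y = w @ s" "c y a = w @ t" "\<Phi> (y, a) = path_from G y (inv_word G s @ t)"
    "nform y @ [a] \<notin> N" and A: "w \<in> lists A" "s \<in> lists A" "t \<in> lists A"
    using flow_cases[OF e] by metis
  have ws: "val (w @ s) = y" using nform(2)[OF e(1)] unfolding w(1) .
  then have y: "y = val w \<otimes> val s" using A by simp
  then have "y \<otimes> val (inv_word G s) = val w" using A by (simp add: m_assoc)
  then have path: "\<Phi> (y, a) = path_from G y (inv_word G s) @ path_from G (val w) t"
    unfolding w(3) using path_from_append[OF e(1), of "inv_word G s" t] A by simp
  have "w @ s \<in> N" using nform(1)[OF e(1)] unfolding w(1) .
  \<comment> \<open>The part labeled by the inverse of \<open>s\<close> ascends in the tree. So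
    \<open>e'\<close> lies on the part labeled \<open>t\<close>, which is the end of the path from
    the identity labeled \<open>c y a\<close>.\<close>
  from up_path[OF A(2) this] have "set (path_from G y (inv_word G s)) \<subseteq> tree_arcs"
    unfolding ws by (simp add: pre_digraph.awalk_def)
  then have "e' \<in> set (path_from G (val w) t)" using e' unfolding path by auto
  then have "e' \<in> set (path_from G \<one> (c y a))"
    unfolding w(2) using path_from_append[OF one_closed A(1), of t] A by simp
  then show ?thesis using chosen_rule_edge_height[OF e(1,2) w(4)] e'(2) by blast
qed

lemma flow_terminates:
  "\<not> (\<exists>f :: nat \<Rightarrow> 'a \<times> 'a. \<forall>i. f i \<in> carrier G \<times> A - tree_arcs \<and> f (Suc i) \<in> set (\<Phi> (f i)))"
proof
  assume "\<exists>f :: nat \<Rightarrow> 'a \<times> 'a. \<forall>i. f i \<in> carrier G \<times> A - tree_arcs \<and> f (Suc i) \<in> set (\<Phi> (f i))"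
  then obtain f where f: "\<And>i. f i \<in> carrier G \<times> A - tree_arcs" "\<And>i. f (Suc i) \<in> set (\<Phi> (f i))" by blast
  define h where "h e = length (nform (fst e)) + length (nform (fst e \<otimes> snd e))" for e
  have h: "edge_height G A (f i) = real (h (f i)) / 2" for i
    using f(1)[of i] edge_height_eq[of "fst (f i)" "snd (f i)"] by (auto simp: h_def mem_Times_iff)
  have "h (f (Suc i)) < h (f i)" for i
  proof -
    have "edge_height G A (f (Suc i)) < edge_height G A (fst (f i), snd (f i))"
      using f(1)[of i] f(1)[of "Suc i"] f(2)[of i] by (intro flow_edge_height) (auto simp: mem_Times_iff)
    then show ?thesis using h[of i] h[of "Suc i"] by simp
  qed
  then have "\<forall>i. (f (Suc i), f i) \<in> measure h" by simp
  then show False using wf_measure[of h] unfolding wf_iff_no_infinite_down_chain by blast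
qed

text \<open>Only finitely many triples \<open>(a, s, t)\<close> occur, and for each of them the normal forms \<open>w s\<close> of
  the vertices \<open>y\<close> with \<open>\<Phi> (y, a)\<close> labeled \<open>s\<inverse> t\<close> form a regular language.\<close>

lemma flow_sync_regular:
  assumes reg: "sync_regular (pairs_as_tuples R)"
  shows "sync_regular {[nform y, [a], path_label (\<Phi> (y, a))] |y a. y \<in> carrier G \<and> a \<in> A}"
proof -
  define C where "C = {(nform y @ [a], c y a) |y a. y \<in> carrier G \<and> a \<in> A \<and> nform y @ [a] \<notin> N}"
  define P where "P a = {x \<in> N. x @ [a] \<in> N} \<union> {x \<in> N. x \<noteq> [] \<and> last x = inv a}" for a
  define Q where "Q = (\<lambda>(a, s, t). (N - P a) \<inter> (\<lambda>w. w @ s) ` {w \<in> lists A. (w @ s @ [a], w @ t) \<in> C})"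
  \<comment> \<open>The words \<open>s\<close> and \<open>t\<close> of an index do not start with
    the same letter, so \<open>w\<close> is the longest common prefix and \<open>flow_split\<close>
    applies.\<close>
  define J where "J = A \<times> {(s, t). s \<in> {s. set s \<subseteq> A \<and> length s \<le> K} \<and> t \<in> {t. set t \<subseteq> A \<and> length t \<le> 2 * K} \<and>
    (s = [] \<or> t = [] \<or> hd s \<noteq> hd t)}"
  have P_iff: "nform y \<in> P a \<longleftrightarrow> (y, a) \<in> tree_arcs" if "y \<in> carrier G" "a \<in> A" for y a
    using that nform(1)[of y] by (auto simp: P_def tree_arcs_def)
  have "J \<subseteq> A \<times> {s. set s \<subseteq> A \<and> length s \<le> K} \<times> {t. set t \<subseteq> A \<and> length t \<le> 2 * K}"
    by (auto simp: J_def)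
  then have finJ: "finite J"
    by (rule finite_subset) (intro finite_cartesian_product finite_A finite_lists_length_le)
  have N: "regular N" using reg by (rule regular_N)
  have regP: "regular (P a)" for a
  proof -
    have "x = butlast x @ [inv a] \<and> butlast x \<in> lists A" if "x \<in> N" "x \<noteq> []" "last x = inv a" for x
      using append_butlast_last_id[OF that(2)] N_lists[OF that(1)] that(3) by (metis append_in_lists_conv)
    then have "x \<in> (\<lambda>w. w @ [inv a]) ` lists A" if "x \<in> N" "x \<noteq> []" "last x = inv a" for x
      using that by (intro image_eqI[of _ _ "butlast x"]) blast+
    then have "{x \<in> N. x \<noteq> [] \<and> last x = inv a} = N \<inter> (\<lambda>w. w @ [inv a]) ` lists A" by fastforce
    moreover have "{x \<in> N. x @ [a] \<in> N} = N \<inter> {x. x @ [a] \<in> N}" by blast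
    ultimately show ?thesis unfolding P_def
      using N finite_A by (simp add: regular_Un regular_Int regular_rquot regular_append_word regular_lists)
  qed
  have "{[nform y @ [a], c y a] |y a. y \<in> carrier G \<and> a \<in> A \<and> nform y @ [a] \<notin> N} = pairs_as_tuples C"
    by (auto simp: pairs_as_tuples_def C_def)
  then have regC: "sync_regular (pairs_as_tuples C)"
    using choice by (simp add: regular_rule_choice_def)
  have regQ: "regular (Q i)" for i
    by (cases i) (simp add: Q_def regular_Int regular_Diff[OF N regP] regular_append_word
        regular_common_prefixes[OF finite_A regC, of "_ @ [_]", simplified])
  \<comment> \<open>With the letter and the path label fixed, only the first component varies, as in
    \<open>sync_regular_Cons_fixed\<close>.\<close>
  have "{[nform y, [a], path_label (\<Phi> (y, a))] |y a. y \<in> carrier G \<and> a \<in> A} =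
      (\<Union>a\<in>A. {x # [[a], [a]] |x. x \<in> P a}) \<union>
      (\<Union>i\<in>J. {x # [[fst i], inv_word G (fst (snd i)) @ snd (snd i)] |x. x \<in> Q i})" (is "?L = ?T \<union> ?F")
  proof (intro equalityI subsetI)
    fix l assume "l \<in> ?L"
    then obtain y a where l: "l = [nform y, [a], path_label (\<Phi> (y, a))]" "y \<in> carrier G" "a \<in> A" by blast
    show "l \<in> ?T \<union> ?F"
    proof (cases "(y, a) \<in> tree_arcs")
      case True
      then have "l = nform y # [[a], [a]]" using l by (simp add: flow_tree path_label_def)
      moreover have "nform y \<in> P a" using P_iff True l by simp
      ultimately show ?thesis using l(3) by blast
    next
      case False
      obtain w s t where w: "nform y = w @ s" "c y a = w @ t" "s = [] \<or> t = [] \<or> hd s \<noteq> hd t"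
        "\<Phi> (y, a) = path_from G y (inv_word G s @ t)" "nform y @ [a] \<notin> N"
        "length s \<le> K" "length t \<le> 2 * K" "w \<in> lists A" "s \<in> lists A" "t \<in> lists A"
        using flow_cases[OF l(2,3) False] .
      have "set s \<subseteq> A" "set t \<subseteq> A" using w(9,10) by auto
      then have J: "(a, s, t) \<in> J" using w l(3) by (simp add: J_def)
      have "(nform y @ [a], c y a) \<in> C" using l w(5) unfolding C_def by blast
      then have "(w @ s @ [a], w @ t) \<in> C" unfolding w(1,2) by simp
      moreover have "nform y \<in> N - P a" using P_iff False l nform(1) by simp
      ultimately have "nform y \<in> Q (a, s, t)" using w(1,8) by (auto simp: Q_def)
      moreover have "l = nform y # [[fst (a, s, t)], inv_word G (fst (snd (a, s, t))) @ snd (snd (a, s, t))]"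
        using l(1) w(4) by simp
      ultimately show ?thesis using J by blast
    qed
  next
    fix l assume "l \<in> ?T \<union> ?F"
    then consider (T) a x where "a \<in> A" "l = x # [[a], [a]]" "x \<in> P a"
      | (F) a s t x where "(a, s, t) \<in> J" "l = x # [[a], inv_word G s @ t]" "x \<in> Q (a, s, t)"
      by fastforce
    then show "l \<in> ?L"
    proof cases
      case T
      then have x: "nform (val x) = x" "val x \<in> carrier G"
        using nform_eqI N_lists by (auto simp: P_def)
      then have "(val x, a) \<in> tree_arcs" using P_iff[of "val x" a] T by simp
      then have "l = [nform (val x), [a], path_label (\<Phi> (val x, a))]"
        using T x by (simp add: flow_tree path_label_def)
      then show ?thesis using T x by blast
    next
      case F
      then obtain w where w: "x = w @ s" "w \<in> lists A" "(w @ s @ [a], w @ t) \<in> C" "x \<in> N" "x \<notin> P a"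
        by (auto simp: Q_def)
      obtain y a' where y: "w @ s @ [a] = nform y @ [a']" "w @ t = c y a'" "y \<in> carrier G" "a' \<in> A"
        using w(3) unfolding C_def by blast
      have y': "nform y = w @ s" "a' = a" "c y a = w @ t" using y(1,2) by auto
      have "(y, a) \<notin> tree_arcs" using P_iff[of y a] w(1,5) y y' by simp
      moreover have "s = [] \<or> t = [] \<or> hd s \<noteq> hd t" using F(1) by (simp add: J_def)
      ultimately have "\<Phi> (y, a) = path_from G y (inv_word G s @ t)"
        using flow_split y y' by simp
      then have "l = [nform y, [a], path_label (\<Phi> (y, a))]" using F(2) w(1) y' by simp
      then show ?thesis using y y' by blast
    qed
  qed
  moreover have "sync_regular ?T" using finite_A regP by (intro sync_regular_UN sync_regular_Cons_fixed)
  moreover have "sync_regular ?F" using finJ regQ by (intro sync_regular_UN sync_regular_Cons_fixed)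
  ultimately show ?thesis using sync_regular_Un by simp
qed

lemma flow_geodesically_autostackable:
  assumes "sync_regular (pairs_as_tuples R)"
  shows "geodesically_autostackable G A tree \<Phi>"
proof -
  let ?triple = "\<lambda>e. [nform (fst e), [snd e], path_label (\<Phi> e)]"
  have "{[tree_nf G tree (tail (cayley G A) e), [snd e], path_label (\<Phi> e)] |e. e \<in> arcs (cayley G A)} =
      ?triple ` (carrier G \<times> A)"
    unfolding Setcompr_eq_image cayley_simps by (rule image_cong) (auto simp: tree_nf_eq)
  also have "\<dots> = {[nform y, [a], path_label (\<Phi> (y, a))] |y a. y \<in> carrier G \<and> a \<in> A}"
    by (auto simp: image_iff)
  finally have "{[tree_nf G tree (tail (cayley G A) e), [snd e], path_label (\<Phi> e)] |e. e \<in> arcs (cayley G A)} =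
      {[nform y, [a], path_label (\<Phi> (y, a))] |y a. y \<in> carrier G \<and> a \<in> A}" .
  then have "sync_regular {[tree_nf G tree (tail (cayley G A) e), [snd e], path_label (\<Phi> e)] |e. e \<in> arcs (cayley G A)}"
    using flow_sync_regular[OF assms] by simp
  moreover have "\<forall>e\<in>arcs (cayley G A).
      pre_digraph.awalk (cayley G A) (tail (cayley G A) e) (\<Phi> e) (head (cayley G A) e)"
    using flow_awalk by auto
  moreover have "\<exists>K. \<forall>e\<in>arcs (cayley G A). length (\<Phi> e) \<le> K" using flow_length by auto
  moreover have "\<forall>e\<in>arcs tree. \<Phi> e = [e]" using flow_tree by simp
  moreover have "\<not> (\<exists>f :: nat \<Rightarrow> 'a \<times> 'a. \<forall>i. f i \<in> arcs (cayley G A) - arcs tree \<and> f (Suc i) \<in> set (\<Phi> (f i)))"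
    using flow_terminates by simp
  ultimately have "regular_bounded_flow G A tree \<Phi>"
    unfolding regular_bounded_flow_def Let_def by (intro conjI)
  moreover have "\<forall>g\<in>carrier G. labels_geodesic G A (tree_nf G tree g)"
    using labels_geodesic_nform tree_nf_eq by simp
  moreover have "\<forall>e\<in>arcs (cayley G A). \<forall>e'\<in>arcs (cayley G A).
      \<Phi> e' \<noteq> [e'] \<and> e' \<in> set (\<Phi> e) \<longrightarrow> edge_height G A e' < edge_height G A e"
  proof (intro ballI impI, elim conjE)
    fix e e' assume e: "e \<in> arcs (cayley G A)" and ne: "\<Phi> e' \<noteq> [e']" and e': "e' \<in> set (\<Phi> e)"
    have "e' \<notin> tree_arcs" using ne flow_tree by blast
    \<comment> \<open>For a tree arc \<open>e\<close> the path is \<open>[e]\<close>, so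
      \<open>e' = e\<close> would be fixed by the flow.\<close>
    moreover have "e \<notin> tree_arcs" using ne e' flow_tree by fastforce
    ultimately show "edge_height G A e' < edge_height G A e"
      using flow_edge_height[of "fst e" "snd e" e'] e e' by (simp add: mem_Times_iff)
  qed
  ultimately show ?thesis
    unfolding geodesically_autostackable_def autostackable_def using spanning_tree by (intro conjI)
qed

end

end

end

theorem theoremC:
  fixes G :: "('a, 'm) monoid_scheme" and A :: "'a set" and R :: "('a list \<times> 'a list) set"
  assumes "group G"
    and "finite A" and "A \<subseteq> carrier G" and "generate G A = carrier G"
    and "\<forall>a\<in>A. inv\<^bsub>G\<^esub> a \<in> A"
    and "cprs G A R"
    and "sync_regular (pairs_as_tuples R)"
    and "length_nonincreasing R"
    and "end_normal G A R"
  shows "sync_regular (pairs_as_tuples (minimal_rules A R)) \<and>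
    (\<forall>M :: ('s, 'a option list) dfa.
       is_dfa M \<and> dfa_lang M = pad ` pairs_as_tuples (minimal_rules A R) \<longrightarrow>
       (\<exists>c. regular_rule_choice G A R (2 * card (dfa_states M)) c) \<and>
       (\<forall>c. regular_rule_choice G A R (2 * card (dfa_states M)) c \<longrightarrow>
          (\<exists>T. cayley_spanning_tree G A T \<and>
               tree_labels G T = irreducibles A R \<and>
               geodesically_autostackable G A T (constructed_flow G A R c))))"
proof -
  interpret group G by (rule assms(1))
  interpret prefix_system G A R
    by unfold_locales (use assms in auto)
  show ?thesis
  proof (intro conjI allI impI; (elim conjE)?)
    show "sync_regular (pairs_as_tuples (minimal_rules A R))"
      using assms(7) by (rule sync_regular_minimal_rules)
    fix M :: "('s, 'a option list) dfa"
    assume M: "is_dfa M" "dfa_lang M = pad ` pairs_as_tuples (minimal_rules A R)"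
    show "\<exists>c. regular_rule_choice G A R (2 * card (dfa_states M)) c"
      using M assms(7) by (rule regular_choice_exists)
    fix c assume c: "regular_rule_choice G A R (2 * card (dfa_states M)) c"
    have "geodesically_autostackable G A tree (constructed_flow G A R c)"
      using M assms(9) c assms(7) by (rule flow_geodesically_autostackable)
    \<comment> \<open>The same tree serves for every automaton \<open>M\<close> and every choice
      \<open>c\<close>.\<close>
    then show "\<exists>T. cayley_spanning_tree G A T \<and> tree_labels G T = irreducibles A R \<and>
        geodesically_autostackable G A T (constructed_flow G A R c)"
      using spanning_tree tree_labels_eq by blast
  qed
qed

end
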